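(* Let $p \geq 7$ be a prime. Then \begin{align*} W_p &\equiv -4\overline{B}_1 + 6\overline{B}_2 - 4\overline{B}_3 + \overline{B}_4 + p\left(-3\overline{B}_1^2 + 4\overline{B}_1\overline{B}_2 - \overline{B}_1\overline{B}_3 - \tfrac{1}{2}\overline{B}_2^2\right)\\ &\quad + p^2\left(-\tfrac{2}{3}\overline{B}_1^3 + \tfrac{1}{2}\overline{B}_1^2\overline{B}_2 - \tfrac{2}{3}\overline{B}_{1,2} + \tfrac{1}{3}\overline{B}_{2,2}\right) - p^3\left(\tfrac{1}{24}\overline{B}_1^4 + \tfrac{1}{3}\overline{B}_1\overline{B}_{1,2}\right) \pmod{p^4}. \end{align*} Equivalently, $(p-1)! \equiv -1 + p\,W_p \pmod{p^5}$ with $W_p$ replaced by the right-hand side above.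
   Context: The Bernoulli numbers $B_n$ are defined by $\frac{t}{e^t-1}=\sum_{n\ge0}B_n\frac{t^n}{n!}$. For a prime $p$, the Wilson quotient is $W_p = \frac{(p-1)!+1}{p}$. For $n\ge1$ define \[ \overline{B}_n = \frac{B_{n(p-1)} + \frac{1}{p} - 1}{n(p-1)}, \qquad \overline{B}_{n,2} = \frac{B_{n(p-1)-2}}{n(p-1)-2}. \] These are $p$-integral rationals; a congruence modulo $p^r$ between $p$-integral rationals means their difference lies in $p^r\mathbb{Z}_p$. *)

theory Defs
  imports "HOL-Computational_Algebra.Computational_Algebra"
begin

(* The exponential generating function is t / (e^t - 1); both numerator and denominator
   have order 1, so the library's division of power series is the genuine quotient. *)
definition bernoulli :: "nat \<Rightarrow> rat" where
  "bernoulli n = fact n * fps_nth (fps_X / (fps_exp 1 - 1)) n"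

definition wilson_quotient :: "nat \<Rightarrow> rat" where
  "wilson_quotient p = (fact (p - 1) + 1) / of_nat p"

definition Bbar :: "nat \<Rightarrow> nat \<Rightarrow> rat" where
  "Bbar p n = (bernoulli (n * (p - 1)) + 1 / of_nat p - 1) / of_nat (n * (p - 1))"

(* The subtractions are on natural numbers; they do not truncate when n >= 1 and p >= 3. *)
definition Bbar2 :: "nat \<Rightarrow> nat \<Rightarrow> rat" where
  "Bbar2 p n = bernoulli (n * (p - 1) - 2) / of_nat (n * (p - 1) - 2)"

(* The p-integral rationals, i.e. the intersection of the rationals with the p-adic integers.
   The condition on b excludes b = 0. *)
definition p_integral :: "nat \<Rightarrow> rat set" where
  "p_integral p = {of_int a / of_int b | a b. \<not> int p dvd b}"

(* Congruence modulo p^r between p-integral rationals. For a rational difference,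
   lying in p^r times the p-adic integers is the same as lying in p^r times the
   p-integral rationals. *)
definition padic_cong :: "nat \<Rightarrow> nat \<Rightarrow> rat \<Rightarrow> rat \<Rightarrow> bool" where
  "padic_cong p r x y \<longleftrightarrow>
     x \<in> p_integral p \<and> y \<in> p_integral p \<and>
     (\<exists>z \<in> p_integral p. x - y = of_nat p ^ r * z)"

end

theory Submission
  imports Defs "HOL-Number_Theory.Residues"
begin

text \<open>
  Raising \<open>(p - 1)! = -1 + p W\<close> to the even power \<open>p - 1\<close> gives
  \<open>(1 - p W) ^ (p - 1) = \<Prod>a<p. a ^ (p - 1)\<close>. Every factor is \<open>1\<close> modulo \<open>p\<close>, so the
  logarithm truncated after degree 4 is additive modulo \<open>p\<^sup>5\<close> and turns the right-hand side into
  a combination of the power sums \<open>\<Sum>a<p. a ^ (n (p - 1))\<close> for \<open>n \<le> 4\<close>, which Faulhaber's formula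
  expresses through \<open>Bbar p n\<close> and \<open>Bbar2 p n\<close>. The latter is linear in \<open>n\<close> modulo \<open>p\<^sup>2\<close> by
  Kummer's congruence, so \<open>n = 1, 2\<close> suffice for it. The truncated exponential recovers \<open>W\<close>
  modulo \<open>p\<^sup>4\<close>. In the resulting polynomial the powers of \<open>4 B\<^sub>1 - 6 B\<^sub>2 + 4 B\<^sub>3 - B\<^sub>4\<close> are shortened by
  the divisibility of the \<open>k\<close>-th differences of \<open>Bbar p\<close> by \<open>p ^ k\<close>, a consequence of
  \<open>(a ^ (p - 1) - 1) ^ (k + 1)\<close> being divisible by \<open>p ^ (k + 1)\<close>.
\<close>

section \<open>Faulhaber's formula\<close>

text \<open>A quotient of power series times its denominator returns the numerator only if the order
  of the numerator is at least that of the denominator. Here both orders are 1.\<close>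

lemma bernoulli_fps_mult:
  "(fps_X / (fps_exp 1 - 1)) * (fps_exp 1 - 1) = (fps_X :: rat fps)"
proof -
  have nz: "fps_exp (1::rat) - 1 \<noteq> 0"
    by simp
  have "subdegree (fps_exp (1::rat) - 1) = 1"
    by (rule subdegreeI) auto
  then show ?thesis
    using fps_times_divide_eq[OF nz, of fps_X] by (simp add: fps_divide_times_eq)
qed

text \<open>The geometric series gives \<open>S\<close> = sum of e^(at) over a < n = (e^(nt) - 1) /
  (e^t - 1). This is the product of \<open>g\<close> = (e^(nt) - 1) / t and \<open>f\<close> = t /
  (e^t - 1), and the formula compares coefficients of t^m.\<close>

lemma sum_powers_bernoulli:
  "(\<Sum>a<n. of_nat a ^ m) =
    (\<Sum>i\<le>m. of_nat (m choose i) * bernoulli (m - i) * (of_nat n ^ (i + 1) / of_nat (i + 1)))"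
proof -
  define f :: "rat fps" where "f = fps_X / (fps_exp 1 - 1)"
  define g :: "rat fps" where "g = Abs_fps (\<lambda>i. of_nat n ^ (i + 1) / fact (i + 1))"
  define S :: "rat fps" where "S = (\<Sum>a<n. fps_exp (of_nat a))"
  have f: "f * (fps_exp 1 - 1) = fps_X"
    unfolding f_def by (rule bernoulli_fps_mult)
  have g: "fps_X * g = fps_exp (of_nat n) - 1"
    by (rule fps_ext) (auto simp: g_def gr0_conv_Suc)
  have "S = (\<Sum>a<n. fps_exp 1 ^ a)"
    by (simp add: S_def fps_exp_power_mult)
  then have "S * (fps_exp 1 - 1) = fps_exp 1 ^ n - 1"
    by (simp only: power_diff_1_eq mult.commute)
  then have "S * (fps_exp 1 - 1) = fps_exp (of_nat n) - 1"
    by (simp add: fps_exp_power_mult)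
  then have "S * (fps_exp 1 - 1) = f * g * (fps_exp 1 - 1)"
    using f g by (metis mult.commute mult.left_commute)
  then have "S = g * f"
    by (simp add: mult.commute)
  then have "fact m * S $ m = fact m * (\<Sum>i\<le>m. g $ i * f $ (m - i))"
    by (simp add: fps_mult_nth atMost_atLeast0)
  also have "\<dots> = (\<Sum>i\<le>m. of_nat (m choose i) * bernoulli (m - i) *
      (of_nat n ^ (i + 1) / of_nat (i + 1)))"
    unfolding sum_distrib_left
  proof (rule sum.cong)
    fix i assume "i \<in> {..m}"
    then have *: "of_nat (m choose i) = (fact m / (fact i * fact (m - i)) :: rat)"
      by (simp add: binomial_fact)
    then show "fact m * (g $ i * f $ (m - i)) = of_nat (m choose i) * bernoulli (m - i) *
        (of_nat n ^ (i + 1) / of_nat (i + 1))"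
      unfolding * bernoulli_def f_def[symmetric] g_def
      by (simp add: divide_simps del: of_nat_Suc)
  qed simp
  finally show ?thesis
    by (simp add: S_def fps_sum_nth of_nat_fact sum_distrib_left)
qed

text \<open>The series \<open>f\<close> = t / (e^t - 1) satisfies f(-t) = f(t) + t, so away from
  degree 1 it has the coefficients of an even series.\<close>

lemma bernoulli_odd_eq_0:
  assumes "odd n" "n \<noteq> 1"
  shows "bernoulli n = 0"
proof -
  define f :: "rat fps" where "f = fps_X / (fps_exp 1 - 1)"
  define h where "h = f oo (- fps_X)"
  have f: "f * (fps_exp 1 - 1) = fps_X"
    unfolding f_def by (rule bernoulli_fps_mult)
  have "h * (fps_exp (-1) - 1) = - fps_X"
    using arg_cong[OF f, of "\<lambda>F. F oo (- fps_X)"] fps_exp_compose_linear[of 1 "-1::rat"]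
    by (simp add: h_def fps_compose_mult_distrib fps_compose_sub_distrib
        flip: fps_const_neg)
  then have "h * (fps_exp (-1) - 1) * fps_exp 1 = - fps_X * fps_exp 1"
    by simp
  moreover have "fps_exp (-1) * fps_exp (1::rat) = 1"
    by (simp flip: fps_exp_add_mult)
  ultimately have "h * (fps_exp 1 - 1) = fps_X * fps_exp 1"
    by (simp add: algebra_simps)
  also have "\<dots> = (f + fps_X) * (fps_exp 1 - 1)"
    using f by (simp add: algebra_simps)
  finally have "h = f + fps_X"
    by simp
  then have "h $ n = f $ n"
    using assms by simp
  moreover have "h $ n = (-1) ^ n * f $ n"
    by (simp add: h_def fps_compose_uminus')
  ultimately show ?thesis
    using assms by (simp add: bernoulli_def f_def)
qed

section \<open>Congruences between p-integral rationals\<close>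

locale prime_ge7 =
  fixes p :: nat
  assumes prime: "prime p" and ge7: "p \<ge> 7"
begin

abbreviation P :: rat where "P \<equiv> of_nat p"

abbreviation Zp :: "rat set" where "Zp \<equiv> p_integral p"

text \<open>Unlike \<open>padic_cong\<close>, this does not ask the two sides to be p-integral, so
  integrality can be deduced from a congruence by \<open>pcong_Zp\<close>.\<close>

definition pcong :: "nat \<Rightarrow> rat \<Rightarrow> rat \<Rightarrow> bool" where
  "pcong r x y \<longleftrightarrow> (\<exists>z\<in>Zp. x - y = P ^ r * z)"

lemma P_nonzero [simp]: "p \<noteq> 0" "P \<noteq> 0"
  using ge7 by auto

lemma Zp_frac: "\<not> int p dvd b \<Longrightarrow> of_int a / of_int b \<in> Zp"
  unfolding p_integral_def by blast

lemma Zp_of_int [simp, intro]: "of_int a \<in> Zp"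
  using Zp_frac[of 1 a] ge7 by auto

lemma Zp_of_nat [simp, intro]: "of_nat a \<in> Zp"
  using Zp_of_int[of "int a"] by simp

lemma Zp_numeral [simp, intro]: "0 \<in> Zp" "1 \<in> Zp" "numeral k \<in> Zp"
  using Zp_of_int[of 0] Zp_of_int[of 1] Zp_of_int[of "numeral k"] by auto

lemma Zp_add [simp, intro]:
  assumes "x \<in> Zp" "y \<in> Zp"
  shows "x + y \<in> Zp"
proof -
  obtain a b c d where x: "x = of_int a / of_int b" "\<not> int p dvd b"
    and y: "y = of_int c / of_int d" "\<not> int p dvd d"
    using assms unfolding p_integral_def by blast
  have "b \<noteq> 0" "d \<noteq> 0"
    using x(2) y(2) by auto
  then have "x + y = of_int (a * d + c * b) / of_int (b * d)"
    using x(1) y(1) by (simp add: field_simps)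
  moreover have "\<not> int p dvd b * d"
    using x(2) y(2) prime by (simp add: prime_dvd_mult_iff)
  ultimately show ?thesis
    by (metis Zp_frac)
qed

lemma Zp_mult [simp, intro]:
  assumes "x \<in> Zp" "y \<in> Zp"
  shows "x * y \<in> Zp"
proof -
  obtain a b c d where x: "x = of_int a / of_int b" "\<not> int p dvd b"
    and y: "y = of_int c / of_int d" "\<not> int p dvd d"
    using assms unfolding p_integral_def by blast
  have "x * y = of_int (a * c) / of_int (b * d)"
    using x(1) y(1) by simp
  moreover have "\<not> int p dvd b * d"
    using x(2) y(2) prime by (simp add: prime_dvd_mult_iff)
  ultimately show ?thesis
    by (metis Zp_frac)
qed

lemma Zp_uminus [simp, intro]: "x \<in> Zp \<Longrightarrow> - x \<in> Zp"
  using Zp_mult[OF Zp_of_int[of "-1"], of x] by simp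

lemma Zp_diff [simp, intro]: "x \<in> Zp \<Longrightarrow> y \<in> Zp \<Longrightarrow> x - y \<in> Zp"
  using Zp_add[of x "- y"] by (simp del: Zp_add)

lemma Zp_power [simp, intro]: "x \<in> Zp \<Longrightarrow> x ^ n \<in> Zp"
  by (induction n) auto

lemma Zp_sum [intro]: "(\<And>i. i \<in> A \<Longrightarrow> f i \<in> Zp) \<Longrightarrow> sum f A \<in> Zp"
  by (induction A rule: infinite_finite_induct) auto

lemma Zp_divide_int: "x \<in> Zp \<Longrightarrow> \<not> int p dvd b \<Longrightarrow> x / of_int b \<in> Zp"
  using Zp_mult[of x "1 / of_int b"] Zp_frac[of b 1] by (simp del: Zp_mult)

lemma Zp_divide_nat: "x \<in> Zp \<Longrightarrow> \<not> p dvd b \<Longrightarrow> x / of_nat b \<in> Zp"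
  using Zp_divide_int[of x "int b"] by simp

lemma not_dvd_less: "0 < b \<Longrightarrow> b < p \<Longrightarrow> \<not> p dvd b"
  using nat_dvd_not_less by blast

text \<open>The prime factors 2, 3, 5 of 60 are units because p >= 7. The power of 60 is large
  enough for the numeral denominators below, and the divisibility is settled by evaluation.\<close>

lemma Zp_divide_numeral [simp]:
  assumes "x \<in> Zp" "numeral k dvd (60 ^ 4 :: nat)"
  shows "x / numeral k \<in> Zp"
proof -
  have "\<not> p dvd numeral k"
  proof
    assume "p dvd numeral k"
    then have "p dvd 60 ^ 4"
      using assms(2) by (rule dvd_trans)
    then have "p dvd 60"
      by (rule prime_dvd_power[OF prime])
    then have "p dvd 3 * 4 * 5"
      by simp
    then have "p dvd 3 \<or> p dvd 4 \<or> p dvd 5"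
      using prime_dvd_multD[OF prime] by blast
    then show False
      using not_dvd_less ge7 by auto
  qed
  from Zp_divide_nat[OF assms(1) this] show ?thesis
    by simp
qed

lemmas Zp_intros = Zp_add Zp_mult Zp_diff Zp_uminus Zp_power Zp_divide_numeral Zp_of_nat Zp_numeral

lemma pcongI: "x - y = P ^ r * z \<Longrightarrow> z \<in> Zp \<Longrightarrow> pcong r x y"
  unfolding pcong_def by blast

lemma pcong_refl [simp, intro]: "pcong r x x"
  by (rule pcongI[where z = 0]) auto

lemma pcongE:
  assumes "pcong r x y"
  obtains z where "x = y + P ^ r * z" "z \<in> Zp"
  using assms unfolding pcong_def by (metis add_diff_cancel_left' diff_add_cancel add.commute)

lemma pcong_sym: "pcong r x y \<Longrightarrow> pcong r y x"
  by (erule pcongE, rule pcongI[where z = "- z" for z]) auto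

lemma pcong_add:
  assumes "pcong r x y" "pcong r x' y'"
  shows "pcong r (x + x') (y + y')"
  using assms by (elim pcongE) (rule pcongI[where z = "z + z'" for z z'], auto simp: distrib_left)

lemma pcong_trans [trans]: "pcong r x y \<Longrightarrow> pcong r y z \<Longrightarrow> pcong r x z"
  using pcong_add[of r x y y z] by (simp add: pcong_def)

lemma pcong_uminus: "pcong r x y \<Longrightarrow> pcong r (- x) (- y)"
  by (erule pcongE, rule pcongI[where z = "- z" for z]) auto

lemma pcong_diff: "pcong r x y \<Longrightarrow> pcong r x' y' \<Longrightarrow> pcong r (x - x') (y - y')"
  using pcong_add[OF _ pcong_uminus, of r x y x' y'] by simp

lemma pcong_scale: "pcong r x y \<Longrightarrow> c \<in> Zp \<Longrightarrow> pcong r (c * x) (c * y)"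
  by (erule pcongE, rule pcongI[where z = "c * z" for z]) (auto simp: algebra_simps)

lemma pcong_mult:
  assumes "pcong r x y" "pcong r x' y'" "x \<in> Zp" "y' \<in> Zp"
  shows "pcong r (x * x') (y * y')"
  using pcong_trans[OF pcong_scale[OF assms(2,3)], of "y * y'"] pcong_scale[OF assms(1,4)]
  by (simp add: mult.commute)

lemma pcong_sum: "(\<And>i. i \<in> A \<Longrightarrow> pcong r (f i) (g i)) \<Longrightarrow> pcong r (sum f A) (sum g A)"
  by (induction A rule: infinite_finite_induct) (auto intro: pcong_add)

lemma pcong_mono:
  assumes "pcong r x y" "s \<le> r"
  shows "pcong s x y"
proof -
  obtain z where z: "x = y + P ^ r * z" "z \<in> Zp"
    using assms(1) by (rule pcongE)
  have "P ^ r = P ^ s * P ^ (r - s)"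
    using assms(2) by (simp flip: power_add)
  then show ?thesis
    using z by (intro pcongI[where z = "P ^ (r - s) * z"]) (auto simp: mult.assoc)
qed

lemma pcong_Zp: "pcong r x y \<Longrightarrow> y \<in> Zp \<Longrightarrow> x \<in> Zp"
  by (erule pcongE) simp

lemma pcong_P_mult: "pcong (r + s) (P ^ s * x) (P ^ s * y) \<longleftrightarrow> pcong r x y"
proof -
  have "(P ^ s * x - P ^ s * y = P ^ (r + s) * z) = (x - y = P ^ r * z)" for z
  proof -
    have "P ^ s * x - P ^ s * y - P ^ (r + s) * z = P ^ s * (x - y - P ^ r * z)"
      by (simp add: algebra_simps power_add)
    moreover have "P ^ s \<noteq> 0"
      by simp
    ultimately show ?thesis
      by (metis mult_eq_0_iff right_minus_eq)
  qed
  then show ?thesis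
    by (simp add: pcong_def)
qed

lemma pcong_P_multI: "pcong r x y \<Longrightarrow> t = r + s \<Longrightarrow> pcong t (P ^ s * x) (P ^ s * y)"
  by (simp add: pcong_P_mult)

lemma pcong_0_iff: "pcong r x 0 \<longleftrightarrow> (\<exists>z\<in>Zp. x = P ^ r * z)"
  by (simp add: pcong_def)

lemma pcong_int:
  assumes "[a = b] (mod int p)"
  shows "pcong 1 (of_int a) (of_int b)"
proof -
  obtain k where "a - b = int p * k"
    using assms by (auto simp: cong_iff_dvd_diff elim: dvdE)
  then have "of_int a - of_int b = P * of_int k"
    by (metis of_int_diff of_int_mult of_int_of_nat_eq)
  then show ?thesis
    by (intro pcongI[where z = "of_int k"]) auto
qed

lemma fermat:
  assumes "\<not> p dvd a"
  shows "pcong 1 (of_nat a ^ (p - 1)) 1"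
proof -
  have "[int (a ^ (p - 1)) = int 1] (mod int p)"
    using fermat_theorem[OF prime assms] by (simp only: cong_int_iff)
  from pcong_int[OF this] show ?thesis
    by simp
qed

lemma wilson: "pcong 1 (fact (p - 1)) (- 1)"
  using pcong_int[of "fact (p - 1)" "-1"] wilson_theorem[OF prime] by simp

section \<open>Power sums modulo powers of p\<close>

definition powsum :: "nat \<Rightarrow> rat" where
  "powsum m = (\<Sum>a\<in>{1..<p}. of_nat a ^ m)"

lemma powsum_Zp [simp, intro]: "powsum m \<in> Zp"
  unfolding powsum_def by auto

text \<open>The exponent of p in i + 1 is at most i - r, since p^(i - r + 1) >= 7^(i - r + 1) > i +
  1.\<close>

lemma P_power_div_Suc:
  assumes "r \<le> 5" "r \<le> i"
  shows "pcong r (P ^ i / of_nat (i + 1)) 0"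
proof -
  obtain e w where ew: "i + 1 = p ^ e * w" "\<not> p dvd w"
    using multiplicity_decompose'[of "i + 1" p] prime not_prime_unit[of p]
    by (metis Suc_eq_plus1 nat.distinct(1))
  then have "w > 0"
    by (metis dvd_0_right gr0I)
  have lt: "i + 1 < 7 ^ (i - r + 1)"
  proof -
    \<comment> \<open>The base case d = 0 reads r + 1 < 7, which is where r <= 5 enters.\<close>
    have "r + d + 1 < 7 ^ (d + 1)" for d
      using \<open>r \<le> 5\<close> by (induction d) auto
    from this[of "i - r"] show ?thesis
      using \<open>r \<le> i\<close> by simp
  qed
  have "e \<le> i - r"
  proof (rule ccontr)
    assume "\<not> e \<le> i - r"
    then have "7 ^ (i - r + 1) \<le> p ^ (i - r + 1)" "p ^ (i - r + 1) \<le> p ^ e"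
      using ge7 by (auto simp del: power_Suc intro!: power_mono power_increasing)
    moreover have "p ^ e \<le> i + 1"
      using ew(1) \<open>w > 0\<close> by simp
    ultimately show False
      using lt by linarith
  qed
  then have "P ^ i = P ^ r * P ^ (i - r - e) * P ^ e"
    using assms by (simp flip: power_add)
  then have "P ^ i / of_nat (i + 1) = P ^ r * (P ^ (i - r - e) / of_nat w)"
    unfolding ew(1) by simp
  then show ?thesis
    using Zp_divide_nat[OF _ ew(2), of "P ^ (i - r - e)"]
    by (intro pcongI[where z = "P ^ (i - r - e) / of_nat w"]) auto
qed

text \<open>A term of Faulhaber's formula for n = p. One factor p of p^(i + 1) is moved to the
  Bernoulli number, which makes both remaining factors p-integral.\<close>

definition fterm :: "nat \<Rightarrow> nat \<Rightarrow> rat" where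
  "fterm m i = of_nat (m choose i) * (P * bernoulli (m - i)) * (P ^ i / of_nat (i + 1))"

lemma powsum_eq_sum_fterm:
  assumes "m > 0"
  shows "powsum m = (\<Sum>i\<le>m. fterm m i)"
proof -
  have "powsum m = (\<Sum>a<p. of_nat a ^ m)"
    unfolding powsum_def using assms
    by (intro sum.mono_neutral_left) (auto simp: not_le)
  then show ?thesis
    unfolding sum_powers_bernoulli fterm_def by (simp add: mult_ac)
qed

text \<open>A weak form of the von Staudt-Clausen theorem: in Faulhaber's formula the term i = 0 is
  \<open>P * bernoulli m\<close>, the terms i >= 1 are integral by induction, and the power sum is
  an integer.\<close>

lemma P_bernoulli_Zp: "P * bernoulli m \<in> Zp"
proof (induction m rule: less_induct)
  case (less m)
  show ?case
  proof (cases "m = 0")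
    case True
    have "bernoulli 0 = 1"
      using sum_powers_bernoulli[where n = 1 and m = 0] by simp
    then show ?thesis
      using True by simp
  next
    case False
    have "fterm m i \<in> Zp" if "i \<in> {1..m}" for i
      unfolding fterm_def
      using Zp_mult[OF Zp_mult[OF Zp_of_nat less.IH[of "m - i"]]
          pcong_Zp[OF P_power_div_Suc[of 0 i] Zp_numeral(1)]] that by auto
    then have "(\<Sum>i\<in>{1..m}. fterm m i) \<in> Zp"
      by (rule Zp_sum)
    moreover have "powsum m = fterm m 0 + (\<Sum>i\<in>{1..m}. fterm m i)"
      using False
      by (simp add: powsum_eq_sum_fterm sum.atLeast1_atMost_eq atMost_atLeast0 sum.atLeast_Suc_atMost)
    moreover have "fterm m 0 = P * bernoulli m"
      by (simp add: fterm_def)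
    ultimately show ?thesis
      by (metis Zp_diff add_diff_cancel_right' powsum_Zp)
  qed
qed

lemma fterm_small:
  assumes "r \<le> 5" "r \<le> i"
  shows "pcong r (fterm m i) 0"
  using pcong_scale[OF P_power_div_Suc[OF assms], of "of_nat (m choose i) * (P * bernoulli (m - i))"]
    P_bernoulli_Zp by (simp add: fterm_def)

lemma powsum_cong_fterms:
  assumes "r \<le> 5" "m > 0"
  shows "pcong r (powsum m) (\<Sum>i<r. fterm m i)"
proof -
  have "pcong r (\<Sum>i\<in>{r..m}. fterm m i) (\<Sum>i\<in>{r..m}. 0)"
    using assms fterm_small by (intro pcong_sum) auto
  \<comment> \<open>If r > m + 1, the range i < r overshoots Faulhaber's formula, but the extra
    binomial coefficients are zero.\<close>
  moreover have "fterm m i = 0" if "i > m" for i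
    using that by (simp add: fterm_def)
  then have "(\<Sum>i<r. fterm m i) = (\<Sum>i\<in>{..<r} \<inter> {..m}. fterm m i)"
    by (intro sum.mono_neutral_right) (auto simp: not_le[symmetric])
  moreover have "powsum m = (\<Sum>i\<in>{..<r} \<inter> {..m}. fterm m i) + (\<Sum>i\<in>{r..m}. fterm m i)"
    unfolding powsum_eq_sum_fterm[OF assms(2)]
    by (subst sum.union_disjoint[symmetric]) (auto intro!: sum.cong)
  ultimately show ?thesis
    using pcong_add[OF pcong_refl[of r "\<Sum>i<r. fterm m i"]] by fastforce
qed

section \<open>Power sums over half of the residues\<close>

definition half :: nat where "half = (p - 1) div 2"

lemma p_eq_half: "p = 2 * half + 1"
  using prime_odd_nat[OF prime] ge7 unfolding half_def by (auto elim: oddE)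

text \<open>The residues are \<open>\<plusminus> a\<close>, but also \<open>\<plusminus> 2 a\<close>, with \<open>a \<le> (p - 1) / 2\<close>. Comparing the two
  descriptions yields \<open>(2\<^sup>k - 1) powsum k\<close> with an explicit factor \<open>k p\<close>, the source of Kummer's
  congruence.\<close>

lemma powsum_halves:
  "powsum k = (\<Sum>a\<in>{1..half}. of_nat a ^ k + (P - of_nat a) ^ k)"
  "powsum k = (\<Sum>a\<in>{1..half}. (2 * of_nat a) ^ k + (P - 2 * of_nat a) ^ k)"
proof -
  have split: "powsum k = (\<Sum>a\<in>{1..half}. of_nat (f a) ^ k + of_nat (p - f a) ^ k)"
    if inj: "inj_on f {1..half}" "inj_on (\<lambda>a. p - f a) {1..half}"
      and un: "f ` {1..half} \<union> (\<lambda>a. p - f a) ` {1..half} = {1..<p}"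
      and disj: "f ` {1..half} \<inter> (\<lambda>a. p - f a) ` {1..half} = {}" for f :: "nat \<Rightarrow> nat"
  proof -
    have "powsum k = sum (\<lambda>a. of_nat a ^ k) (f ` {1..half})
        + sum (\<lambda>a. of_nat a ^ k) ((\<lambda>a. p - f a) ` {1..half})"
      unfolding powsum_def un[symmetric] using disj by (intro sum.union_disjoint) auto
    then show ?thesis
      by (simp only: sum.reindex[OF inj(1)] sum.reindex[OF inj(2)] sum.distrib o_def)
  qed
  have "{1..half} \<union> (\<lambda>a. p - a) ` {1..half} = {1..<p}"
  proof -
    have "a \<in> (\<lambda>a. p - a) ` {1..half}" if "a \<in> {1..<p}" "a \<notin> {1..half}" for a
      using that p_eq_half by (intro image_eqI[where x = "p - a"]) auto
    then have "{1..<p} \<subseteq> {1..half} \<union> (\<lambda>a. p - a) ` {1..half}"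
      by blast
    then show ?thesis
      using p_eq_half by auto
  qed
  then have "powsum k = (\<Sum>a\<in>{1..half}. of_nat a ^ k + of_nat (p - a) ^ k)"
    using p_eq_half by (intro split) (auto simp: inj_on_def)
  then show "powsum k = (\<Sum>a\<in>{1..half}. of_nat a ^ k + (P - of_nat a) ^ k)"
    using p_eq_half by (simp add: of_nat_diff)
  have "(\<lambda>a. 2 * a) ` {1..half} \<union> (\<lambda>a. p - 2 * a) ` {1..half} = {1..<p}"
  proof -
    have "a \<in> (\<lambda>a. 2 * a) ` {1..half}" if "a \<in> {1..<p}" "even a" for a
      using that p_eq_half by (intro image_eqI[where x = "a div 2"]) auto
    moreover have "a \<in> (\<lambda>a. p - 2 * a) ` {1..half}" if "a \<in> {1..<p}" "odd a" for a
    proof -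
      obtain b where "a = 2 * b + 1"
        using \<open>odd a\<close> by (rule oddE)
      then show ?thesis
        using that p_eq_half by (intro image_eqI[where x = "half - b"]) auto
    qed
    ultimately have "{1..<p} \<subseteq> (\<lambda>a. 2 * a) ` {1..half} \<union> (\<lambda>a. p - 2 * a) ` {1..half}"
      by blast
    then show ?thesis
      using p_eq_half by auto
  qed
  moreover have "2 * a \<noteq> p - 2 * b" if "b \<in> {1..half}" for a b
    using that p_eq_half by (simp, presburger)
  ultimately have "powsum k = (\<Sum>a\<in>{1..half}. of_nat (2 * a) ^ k + of_nat (p - 2 * a) ^ k)"
    using p_eq_half by (intro split) (auto simp: inj_on_def)
  then show "powsum k = (\<Sum>a\<in>{1..half}. (2 * of_nat a) ^ k + (P - 2 * of_nat a) ^ k)"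
    using p_eq_half by (simp add: of_nat_diff)
qed

lemma power_diff_P:
  assumes x: "x \<in> Zp"
  shows "pcong 3 ((x - P) ^ (n + 2))
    (x ^ (n + 2) - of_nat (n + 2) * P * x ^ (n + 1)
      + of_nat (n + 2) * of_nat (n + 1) / 2 * P ^ 2 * x ^ n)"
proof (induction n)
  case 0
  then show ?case
    by (simp add: power2_eq_square algebra_simps)
next
  case (Suc n)
  let ?c = "of_nat (n + 2) * of_nat (n + 1) / 2 :: rat"
  have "pcong 3 ((x - P) ^ (Suc n + 2)) ((x - P) * (x ^ (n + 2)
      - of_nat (n + 2) * P * x ^ (n + 1) + ?c * P ^ 2 * x ^ n))"
    using pcong_scale[OF Suc, of "x - P"] x by simp
  also have "pcong 3 \<dots> (x ^ (Suc n + 2) - of_nat (Suc n + 2) * P * x ^ (Suc n + 1)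
      + of_nat (Suc n + 2) * of_nat (Suc n + 1) / 2 * P ^ 2 * x ^ Suc n)"
    using x
    \<comment> \<open>The witness is the only term of the product with a factor p^3.\<close>
    by (intro pcongI[where z = "- (?c * x ^ n)"])
      (auto simp: field_simps power2_eq_square power3_eq_cube)
  finally show ?case .
qed

lemma power_P_diff:
  assumes x: "x \<in> Zp" and k: "even k" "k \<ge> 2"
  shows "pcong 3 ((P - x) ^ k)
    (x ^ k - of_nat k * P * x ^ (k - 1) + of_nat k * (of_nat k - 1) / 2 * P ^ 2 * x ^ (k - 2))"
proof -
  obtain n where n: "k = n + 2"
    using k(2) by (metis le_add_diff_inverse2)
  have "(P - x) ^ k = (x - P) ^ k"
    using k(1) by (metis minus_diff_eq power_minus_even)
  then show ?thesis
    using power_diff_P[OF x, of n] unfolding n by simp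
qed

text \<open>Both descriptions of the power sum are expanded to second order in p, with summand
  \<open>F\<close> at a and at 2a. In \<open>2 ^ k * F a - F (2 * a)\<close> the leading terms of
  degree k cancel, and each surviving term carries the factor k p. The coefficient 3 / 2 is (4 - 1)
  / 2.\<close>

lemma powsum_doubling:
  assumes k: "even k" "k \<ge> 2"
  shows "pcong 3 ((2 ^ k - 1) * powsum k)
    (of_nat k * P * (\<Sum>a\<in>{1..half}. 3 / 2 * (P * (of_nat k - 1)) * (2 * of_nat a) ^ (k - 2)
      - (2 * of_nat a) ^ (k - 1)))"
proof -
  define F :: "rat \<Rightarrow> rat" where "F x = x ^ k + (x ^ k - of_nat k * P * x ^ (k - 1)
    + of_nat k * (of_nat k - 1) / 2 * P ^ 2 * x ^ (k - 2))" for x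
  have "pcong 3 (powsum k) (\<Sum>a\<in>{1..half}. F (of_nat a))"
    unfolding powsum_halves(1) F_def
    by (intro pcong_sum pcong_add pcong_refl power_P_diff k) auto
  moreover have "pcong 3 (powsum k) (\<Sum>a\<in>{1..half}. F (2 * of_nat a))"
    unfolding powsum_halves(2) F_def
    by (intro pcong_sum pcong_add pcong_refl power_P_diff k) auto
  ultimately have "pcong 3 (2 ^ k * powsum k - powsum k)
      (2 ^ k * (\<Sum>a\<in>{1..half}. F (of_nat a)) - (\<Sum>a\<in>{1..half}. F (2 * of_nat a)))"
    by (intro pcong_diff pcong_scale) auto
  also have "2 ^ k * (\<Sum>a\<in>{1..half}. F (of_nat a)) - (\<Sum>a\<in>{1..half}. F (2 * of_nat a))
    = (\<Sum>a\<in>{1..half}. 2 ^ k * F (of_nat a) - F (2 * of_nat a))"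
    by (simp add: sum_distrib_left sum_subtractf)
  also have "\<dots> = (\<Sum>a\<in>{1..half}. of_nat k * P *
      (3 / 2 * (P * (of_nat k - 1)) * (2 * of_nat a) ^ (k - 2) - (2 * of_nat a) ^ (k - 1)))"
  proof (rule sum.cong)
    fix a
    obtain n where n: "k = n + 2"
      using k(2) by (metis le_add_diff_inverse2)
    show "2 ^ k * F (of_nat a) - F (2 * of_nat a) = of_nat k * P *
      (3 / 2 * (P * (of_nat k - 1)) * (2 * of_nat a) ^ (k - 2) - (2 * of_nat a) ^ (k - 1))"
      unfolding F_def n by (simp add: power_mult_distrib power2_eq_square field_simps)
  qed simp
  finally show ?thesis
    by (simp add: sum_distrib_left algebra_simps)
qed

section \<open>Power sums and Bernoulli numbers near multiples of p - 1\<close>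

definition M :: "nat \<Rightarrow> nat" where "M n = n * (p - 1)"

lemma M_props:
  assumes "n \<ge> 1"
  shows "M n \<ge> 6" "even (M n)"
proof -
  have "p - 1 = 2 * half"
    using p_eq_half by linarith
  then show "even (M n)"
    by (simp add: M_def)
  show "M n \<ge> 6"
    using assms ge7 mult_le_mono[of 1 n 6 "p - 1"] by (simp add: M_def)
qed

lemma of_nat_M: "of_nat (M n) = of_nat n * (P - 1)"
  using ge7 by (simp add: M_def of_nat_diff)

lemma power_M_cong:
  assumes "\<not> p dvd a"
  shows "pcong 1 (of_nat a ^ M n) 1"
proof (induction n)
  case (Suc n)
  then show ?case
    using pcong_mult[OF fermat[OF assms] Suc] by (simp add: M_def power_add)
qed (simp add: M_def)

text \<open>For k = \<open>M n - j\<close>, doubling shows that p divides (2^k - 1)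
  \<open>powsum k\<close>. By Fermat 2^j (2^k - 1) is congruent to 1 - 2^j, a unit, so p divides
  \<open>powsum k\<close>, which is congruent to \<open>P * bernoulli k\<close> modulo p.\<close>

lemma bernoulli_Zp:
  assumes n: "n \<ge> 1" and j: "j = 2 \<or> j = 4"
  shows "bernoulli (M n - j) \<in> Zp"
proof -
  define k where "k = M n - j"
  have k: "even k" "k \<ge> 2" "k + j = M n"
    using M_props[OF n] j unfolding k_def by auto
  have "pcong 3 ((2 ^ k - 1) * powsum k) (P * (of_nat k * (\<Sum>a\<in>{1..half}.
      3 / 2 * (P * (of_nat k - 1)) * (2 * of_nat a) ^ (k - 2) - (2 * of_nat a) ^ (k - 1))))"
    using powsum_doubling[OF k(1,2)] by (simp add: mult_ac)
  then have "pcong 1 ((2 ^ k - 1) * powsum k) (P * (of_nat k * (\<Sum>a\<in>{1..half}.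
      3 / 2 * (P * (of_nat k - 1)) * (2 * of_nat a) ^ (k - 2) - (2 * of_nat a) ^ (k - 1))))"
    by (rule pcong_mono) simp
  also have "pcong 1 \<dots> 0"
    by (rule pcongI[where z = "of_nat k * (\<Sum>a\<in>{1..half}. 3 / 2 * (P * (of_nat k - 1))
        * (2 * of_nat a) ^ (k - 2) - (2 * of_nat a) ^ (k - 1))"], simp)
      (intro Zp_mult Zp_sum Zp_diff, auto)
  finally have "pcong 1 (2 ^ j * ((2 ^ k - 1) * powsum k)) (2 ^ j * 0)"
    by (rule pcong_scale) auto
  moreover have "pcong 1 (2 ^ M n) 1"
    using power_M_cong[of 2] not_dvd_less[of 2] ge7 by simp
  then have "pcong 1 (powsum k * (2 ^ M n - 2 ^ j)) (powsum k * (1 - 2 ^ j))"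
    by (intro pcong_scale pcong_diff) auto
  moreover have "2 ^ j * ((2 ^ k - 1) * powsum k) = powsum k * (2 ^ M n - 2 ^ j)"
    unfolding k(3)[symmetric] by (simp add: power_add algebra_simps)
  ultimately have *: "pcong 1 (powsum k * (1 - 2 ^ j)) 0"
    using pcong_trans pcong_sym by (metis mult_zero_right)
  \<comment> \<open>The denominator is -3 or -15.\<close>
  have "1 / (1 - 2 ^ j) \<in> Zp"
    using j by auto
  from pcong_scale[OF * this] have "pcong 1 (powsum k) 0"
    using j by auto
  moreover have "pcong 1 (powsum k) (P * bernoulli k)"
    using powsum_cong_fterms[of 1 k] k by (simp add: fterm_def)
  ultimately have "pcong 1 (P * bernoulli k) 0"
    using pcong_trans pcong_sym by blast
  then show ?thesis
    by (auto simp: pcong_0_iff k_def)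
qed

text \<open>The Faulhaber term i = 1 contains a Bernoulli number of odd index, and the term i = 2 is
  divisible by p^3 because \<open>bernoulli (M n - 4)\<close> is integral.\<close>

lemma powsum_cong_3:
  assumes n: "n \<ge> 1"
  shows "pcong 3 (powsum (M n - 2)) (P * bernoulli (M n - 2))"
proof -
  let ?k = "M n - 2"
  have M: "M n \<ge> 6" "even (M n)"
    using M_props[OF n] by auto
  have "bernoulli (?k - 1) = 0"
    using M by (intro bernoulli_odd_eq_0) auto
  then have "(\<Sum>i<3. fterm ?k i) = P * bernoulli ?k + fterm ?k 2"
    by (simp add: fterm_def eval_nat_numeral)
  moreover have "fterm ?k 2 = P ^ 3 * (of_nat (?k choose 2) * bernoulli (M n - 4) / 3)"
    by (simp add: fterm_def power2_eq_square power3_eq_cube)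
  then have "pcong 3 (fterm ?k 2) 0"
    using Zp_mult[OF Zp_of_nat bernoulli_Zp[OF n, of 4]]
    by (intro pcongI[where z = "of_nat (?k choose 2) * bernoulli (M n - 4) / 3"]) simp_all
  ultimately show ?thesis
    using powsum_cong_fterms[of 3 ?k] M
      pcong_add[OF pcong_refl[of 3 "P * bernoulli ?k"], of "fterm ?k 2" 0]
    by (auto intro: pcong_trans)
qed

lemma Bbar_eq:
  assumes "n \<ge> 1"
  shows "P * bernoulli (M n) = P - 1 + P * (of_nat (M n) * Bbar p n)"
  unfolding Bbar_def M_def[symmetric] using M_props[OF assms] by (simp add: field_simps)

lemma Bbar2_eq:
  assumes "n \<ge> 1"
  shows "bernoulli (M n - 2) = (of_nat (M n) - 2) * Bbar2 p n"
  unfolding Bbar2_def M_def[symmetric] using M_props[OF assms] by (auto simp: of_nat_diff)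

text \<open>The Faulhaber terms i = 1 and i = 3 vanish by parity, i = 0 yields
  \<open>Bbar p n\<close>, i = 2 yields \<open>Bbar2 p n\<close>, and i = 4 is divisible by p^5
  because \<open>bernoulli (M n - 4)\<close> is integral.\<close>

lemma powsum_cong_5:
  assumes n: "n \<ge> 1"
  shows "pcong 5 (powsum (M n)) (P - 1 + P * (of_nat (M n) * Bbar p n)
    + P ^ 3 / 6 * (of_nat (M n) * (of_nat (M n) - 1) * (of_nat (M n) - 2) * Bbar2 p n))"
    (is "pcong 5 _ ?R")
proof -
  have M: "M n \<ge> 6" "even (M n)"
    using M_props[OF n] by auto
  have "bernoulli (M n - 1) = 0" "bernoulli (M n - 3) = 0"
    using M by (auto intro!: bernoulli_odd_eq_0)
  then have "(\<Sum>i<5. fterm (M n) i) = P * bernoulli (M n) + fterm (M n) 2 + fterm (M n) 4"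
    by (simp add: fterm_def eval_nat_numeral)
  also have "fterm (M n) 2 = P ^ 3 / 6 *
      (of_nat (M n) * (of_nat (M n) - 1) * (of_nat (M n) - 2) * Bbar2 p n)"
  proof -
    have "2 * (M n choose 2) = M n * (M n - 1)"
      using M(2) by (simp add: choose_two)
    then have "2 * of_nat (M n choose 2) = (of_nat (M n) * (of_nat (M n) - 1) :: rat)"
      using M(1) by (metis of_nat_mult of_nat_numeral of_nat_diff of_nat_1 le_trans one_le_numeral)
    then have *: "of_nat (M n choose 2) = (of_nat (M n) * (of_nat (M n) - 1) / 2 :: rat)"
      by simp
    show ?thesis
      unfolding fterm_def Bbar2_eq[OF n] * by (simp add: power2_eq_square power3_eq_cube)
  qed
  also have "P * bernoulli (M n) + \<dots> = ?R"
    by (simp add: Bbar_eq[OF n])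
  finally have "(\<Sum>i<5. fterm (M n) i) = ?R + fterm (M n) 4" .
  moreover have "fterm (M n) 4 = P ^ 5 * (of_nat (M n choose 4) * bernoulli (M n - 4) / 5)"
    by (simp add: fterm_def eval_nat_numeral)
  then have "pcong 5 (fterm (M n) 4) 0"
    using Zp_mult[OF Zp_of_nat bernoulli_Zp[OF n, of 4]]
    by (intro pcongI[where z = "of_nat (M n choose 4) * bernoulli (M n - 4) / 5"]) simp_all
  ultimately show ?thesis
    using powsum_cong_fterms[of 5 "M n"] M
      pcong_add[OF pcong_refl[of 5 ?R], of "fterm (M n) 4" 0]
    by (auto intro: pcong_trans)
qed

lemma not_dvd_M:
  assumes "n \<in> {1..4}"
  shows "\<not> p dvd M n" "\<not> p dvd M n - 2"
proof -
  show "\<not> p dvd M n"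
    using assms ge7 prime not_dvd_less[of n] not_dvd_less[of "p - 1"]
    by (simp add: M_def prime_dvd_mult_iff)
  show "\<not> p dvd M n - 2"
  proof
    assume "p dvd M n - 2"
    \<comment> \<open>Modulo p, \<open>M n - 2\<close> is -(n + 2), and n + 2 <= 6 < p.\<close>
    moreover have "n * (p - 1) + n = n * p"
      using ge7 by (simp add: diff_mult_distrib2)
    then have "M n - 2 + (n + 2) = n * p"
      using M_props(1)[of n] assms by (simp add: M_def)
    ultimately have "p dvd n + 2"
      by (metis dvd_add_right_iff dvd_triv_right)
    then show False
      using assms ge7 not_dvd_less[of "n + 2"] by simp
  qed
qed

lemma powsum_M: "powsum (M n) = (\<Sum>a\<in>{1..<p}. (of_nat a ^ (p - 1)) ^ n)"
  unfolding powsum_def M_def by (simp add: mult.commute flip: power_mult)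

lemma not_dvd_range: "a \<in> {1..<p} \<Longrightarrow> \<not> p dvd a"
  using not_dvd_less by auto

text \<open>Fermat's theorem and Faulhaber's formula each evaluate the power sum modulo p.
  Comparison shows that \<open>P * (of_nat (M n) * Bbar p n)\<close> is divisible by p, and
  \<open>M n\<close> is a unit.\<close>

lemma Bbar_Zp:
  assumes "n \<in> {1..4}"
  shows "Bbar p n \<in> Zp"
proof -
  have n: "n \<ge> 1"
    using assms by simp
  have "pcong 1 (powsum (M n)) (\<Sum>a\<in>{1..<p}. 1)"
    unfolding powsum_def by (intro pcong_sum power_M_cong not_dvd_range)
  then have "pcong 1 (powsum (M n)) (P - 1)"
    using ge7 by (simp add: of_nat_diff)
  moreover have "pcong 1 (powsum (M n)) (P - 1 + P * (of_nat (M n) * Bbar p n))"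
    using powsum_cong_fterms[of 1 "M n"] M_props[OF n] by (simp add: fterm_def Bbar_eq[OF n])
  ultimately have "pcong 1 (P - 1 + P * (of_nat (M n) * Bbar p n) - (P - 1)) (P - 1 - (P - 1))"
    by (intro pcong_diff pcong_refl) (blast intro: pcong_trans pcong_sym)
  then have "of_nat (M n) * Bbar p n \<in> Zp"
    by (auto simp: pcong_0_iff)
  from Zp_divide_nat[OF this not_dvd_M(1)[OF assms]] show ?thesis
    using M_props(1)[OF n] by simp
qed

lemma Bbar2_Zp:
  assumes "n \<in> {1..4}"
  shows "Bbar2 p n \<in> Zp"
  using Zp_divide_nat[OF bernoulli_Zp[of n 2] not_dvd_M(2)[OF assms]] assms
  unfolding Bbar2_def M_def by simp

section \<open>Kummer's congruence\<close>

text \<open>Sequences that are linear in \<open>n\<close> modulo \<open>p\<^sup>2\<close> with slope divisible by \<open>p\<close>; they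
  form a ring, which is what makes the Kummer congruence modulo \<open>p\<^sup>2\<close> work.\<close>

definition affine_mod :: "(nat \<Rightarrow> rat) \<Rightarrow> bool" where
  "affine_mod g \<longleftrightarrow> (\<exists>\<alpha>\<in>Zp. \<exists>\<beta>\<in>Zp. \<forall>n\<in>{1..4}. pcong 2 (g n) (\<alpha> + P * \<beta> * of_nat n))"

lemma affine_modI:
  assumes "\<And>n. n \<in> {1..4} \<Longrightarrow> pcong 2 (g n) (\<alpha> + P * \<beta> * of_nat n)" "\<alpha> \<in> Zp" "\<beta> \<in> Zp"
  shows "affine_mod g"
  unfolding affine_mod_def using assms by blast

lemma affine_modE:
  assumes "affine_mod g"
  obtains \<alpha> \<beta> where "\<alpha> \<in> Zp" "\<beta> \<in> Zp"
    "\<And>n. n \<in> {1..4} \<Longrightarrow> pcong 2 (g n) (\<alpha> + P * \<beta> * of_nat n)"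
  using assms unfolding affine_mod_def by blast

lemma affine_mod_cong:
  assumes "affine_mod h" "\<And>n. n \<in> {1..4} \<Longrightarrow> pcong 2 (g n) (h n)"
  shows "affine_mod g"
  using assms(1) by (rule affine_modE) (rule affine_modI, blast intro: assms(2) pcong_trans)

lemma affine_mod_const: "c \<in> Zp \<Longrightarrow> affine_mod (\<lambda>n. c)"
  by (rule affine_modI[where \<alpha> = c and \<beta> = 0]) auto

lemma affine_mod_add:
  assumes "affine_mod f" "affine_mod g"
  shows "affine_mod (\<lambda>n. f n + g n)"
proof -
  obtain \<alpha> \<beta> where f: "\<alpha> \<in> Zp" "\<beta> \<in> Zp" "\<And>n. n \<in> {1..4} \<Longrightarrow> pcong 2 (f n) (\<alpha> + P * \<beta> * of_nat n)"
    using assms(1) by (rule affine_modE) blast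
  obtain \<alpha>' \<beta>' where g: "\<alpha>' \<in> Zp" "\<beta>' \<in> Zp" "\<And>n. n \<in> {1..4} \<Longrightarrow> pcong 2 (g n) (\<alpha>' + P * \<beta>' * of_nat n)"
    using assms(2) by (rule affine_modE) blast
  show ?thesis
  proof (rule affine_modI[where \<alpha> = "\<alpha> + \<alpha>'" and \<beta> = "\<beta> + \<beta>'"])
    show "pcong 2 (f n + g n) (\<alpha> + \<alpha>' + P * (\<beta> + \<beta>') * of_nat n)" if "n \<in> {1..4}" for n
      using pcong_add[OF f(3)[OF that] g(3)[OF that]] by (simp add: algebra_simps)
  qed (use f g in auto)
qed

lemma affine_mod_mult:
  assumes "affine_mod f" "affine_mod g"
  shows "affine_mod (\<lambda>n. f n * g n)"
proof -
  obtain \<alpha> \<beta> where f: "\<alpha> \<in> Zp" "\<beta> \<in> Zp" "\<And>n. n \<in> {1..4} \<Longrightarrow> pcong 2 (f n) (\<alpha> + P * \<beta> * of_nat n)"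
    using assms(1) by (rule affine_modE) blast
  obtain \<alpha>' \<beta>' where g: "\<alpha>' \<in> Zp" "\<beta>' \<in> Zp" "\<And>n. n \<in> {1..4} \<Longrightarrow> pcong 2 (g n) (\<alpha>' + P * \<beta>' * of_nat n)"
    using assms(2) by (rule affine_modE) blast
  show ?thesis
  proof (rule affine_modI[where \<alpha> = "\<alpha> * \<alpha>'" and \<beta> = "\<alpha> * \<beta>' + \<alpha>' * \<beta>"])
    fix n :: nat assume n: "n \<in> {1..4}"
    have "f n \<in> Zp"
      using pcong_Zp[OF f(3)[OF n]] f by simp
    then have "pcong 2 (f n * g n) ((\<alpha> + P * \<beta> * of_nat n) * (\<alpha>' + P * \<beta>' * of_nat n))"
      using f g n by (intro pcong_mult) auto
    also have "pcong 2 \<dots> (\<alpha> * \<alpha>' + P * (\<alpha> * \<beta>' + \<alpha>' * \<beta>) * of_nat n)"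
      using f g
      \<comment> \<open>Both slopes carry a factor p, so the quadratic term vanishes modulo
        p^2.\<close>
      by (intro pcongI[where z = "\<beta> * \<beta>' * of_nat n * of_nat n"])
        (auto simp: algebra_simps power2_eq_square)
    finally show "pcong 2 (f n * g n) \<dots>" .
  qed (use f g in auto)
qed

lemma affine_mod_sum:
  "(\<And>a. a \<in> A \<Longrightarrow> affine_mod (f a)) \<Longrightarrow> affine_mod (\<lambda>n. \<Sum>a\<in>A. f a n)"
  by (induction A rule: infinite_finite_induct)
    (auto intro: affine_mod_const affine_mod_add)

lemma one_plus_P_power:
  assumes q: "q \<in> Zp"
  shows "pcong 2 ((1 + P * q) ^ n) (1 + P * q * of_nat n)"
proof (induction n)
  case (Suc n)
  have "pcong 2 ((1 + P * q) ^ Suc n) ((1 + P * q) * (1 + P * q * of_nat n))"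
    using pcong_scale[OF Suc, of "1 + P * q"] q by simp
  also have "pcong 2 \<dots> (1 + P * q * of_nat (Suc n))"
    using q by (intro pcongI[where z = "q * q * of_nat n"]) (auto simp: algebra_simps power2_eq_square)
  finally show ?case .
qed simp

lemma affine_mod_power_M:
  assumes a: "\<not> p dvd a" and j: "j \<le> p - 1"
  shows "affine_mod (\<lambda>n. of_nat a ^ (M n - j))"
proof -
  obtain q where q: "q \<in> Zp" "of_nat a ^ (p - 1) = 1 + P * q"
    using fermat[OF a] by (rule pcongE) auto
  define c :: rat where "c = of_nat a ^ (p - 1 - j)"
  show ?thesis
  \<comment> \<open>The base 1 + p q is raised to the power n - 1, not n, hence the correction -p q
    in the constant term.\<close>
  proof (rule affine_modI[where \<alpha> = "c * (1 - P * q)" and \<beta> = "c * q"])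
    fix n :: nat assume "n \<in> {1..4}"
    then obtain m where n: "n = Suc m"
      by (cases n) auto
    have "M n - j = (p - 1 - j) + (p - 1) * m"
      using j by (simp add: M_def n mult.commute)
    then have "of_nat a ^ (M n - j) = c * (1 + P * q) ^ m"
      by (simp only: power_add power_mult c_def q(2))
    then show "pcong 2 (of_nat a ^ (M n - j)) (c * (1 - P * q) + P * (c * q) * of_nat n)"
      using pcong_scale[OF one_plus_P_power[OF q(1), of m], of c]
      by (simp add: c_def n algebra_simps)
  qed (use q in \<open>auto simp: c_def\<close>)
qed

text \<open>For k = \<open>M n - 2\<close>, evaluating (2^k - 1) \<open>powsum k\<close> modulo p^3
  in two ways and cancelling the factor k p gives (2^k - 1) \<open>Bbar2 p n\<close> congruent to
  \<open>G n\<close> modulo p^2. Both \<open>G\<close> and the inverse of 2^k - 1 are affine, and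
  affine sequences are closed under products.\<close>

lemma Kummer_Bbar2: "affine_mod (Bbar2 p)"
proof -
  \<comment> \<open>This is the sum in \<open>powsum_doubling\<close> at k = \<open>M n - 2\<close>,
    for which k - 1 = n (p - 1) - 3.\<close>
  define G where "G n = (\<Sum>a\<in>{1..half}. 3 / 2 * (P * (of_nat n * (P - 1) - 3)) *
      of_nat (2 * a) ^ (M n - 4) + (-1) * of_nat (2 * a) ^ (M n - 3))" for n
  have lin: "affine_mod (\<lambda>n. P * (of_nat n * (P - 1) - 3))"
    by (rule affine_modI[where \<alpha> = "- 3 * P" and \<beta> = "- 1"], rule pcongI[where z = "of_nat n" for n])
      (auto simp: algebra_simps power2_eq_square)
  have ndvd: "\<not> p dvd 2 * a" if "a \<in> {1..half}" for a
    using that p_eq_half not_dvd_less[of "2 * a"] by simp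
  have G: "affine_mod G"
    unfolding G_def using ge7
    by (intro affine_mod_sum affine_mod_add affine_mod_mult affine_mod_const lin
        affine_mod_power_M ndvd) auto
  obtain q where q: "q \<in> Zp" "2 ^ (p - 1) = 1 + P * q"
    using fermat[of 2] not_dvd_less[of 2] ge7 by (auto elim: pcongE)
  \<comment> \<open>The inverse of 2^k - 1 modulo p^2: since 4 * 2^k = (1 + p q)^n, the number 2^k -
    1 is congruent to (p q n - 3) / 4, whose inverse is -(4/3) / (1 - p q n / 3).\<close>
  have v: "affine_mod (\<lambda>n. - 4 / 3 - 4 / 9 * P * q * of_nat n)"
  proof (rule affine_modI[where \<alpha> = "- 4 / 3" and \<beta> = "- 4 * q / 9"])
    show "pcong 2 (- 4 / 3 - 4 / 9 * P * q * of_nat n) (- 4 / 3 + P * (- 4 * q / 9) * of_nat n)" for n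
      by (rule pcongI[where z = 0]) (simp_all add: field_simps)
    show "- 4 * q / 9 \<in> Zp"
      by (intro Zp_divide_numeral Zp_mult Zp_uminus Zp_numeral q(1)) simp
  qed auto
  show ?thesis
  proof (rule affine_mod_cong[OF affine_mod_mult[OF v G]])
    fix n :: nat assume n: "n \<in> {1..4}"
    then have M: "M n \<ge> 6" "even (M n)"
      using M_props by auto
    let ?b = "Bbar2 p n" and ?k = "M n - 2"
    let ?v = "- 4 / 3 - 4 / 9 * P * q * of_nat n"
    have b: "?b \<in> Zp"
      using n by (rule Bbar2_Zp)
    have k: "of_nat ?k = (of_nat n * (P - 1) - 2 :: rat)"
      using M by (simp add: of_nat_diff of_nat_M)
    have "pcong 3 ((2 ^ ?k - 1) * (P * bernoulli ?k)) ((2 ^ ?k - 1) * powsum ?k)"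
      using n by (intro pcong_scale pcong_sym[OF powsum_cong_3]) auto
    also have "pcong 3 \<dots> (P * (of_nat ?k * G n))"
    proof -
      have "(\<Sum>a\<in>{1..half}. 3 / 2 * (P * (of_nat ?k - 1)) * (2 * of_nat a) ^ (?k - 2)
          - (2 * of_nat a) ^ (?k - 1)) = G n"
        unfolding G_def k by simp
      then show ?thesis
        using powsum_doubling[of ?k] M by (simp add: mult_ac)
    qed
    also have "bernoulli ?k = of_nat ?k * ?b"
      using Bbar2_eq[of n] n M by (simp add: of_nat_diff)
    finally have "pcong (2 + 1) (P ^ 1 * ((2 ^ ?k - 1) * (of_nat ?k * ?b))) (P ^ 1 * (of_nat ?k * G n))"
      by (simp add: mult_ac)
    then have "pcong 2 ((2 ^ ?k - 1) * (of_nat ?k * ?b)) (of_nat ?k * G n)"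
      by (simp only: pcong_P_mult)
    then have "pcong 2 (1 / of_nat ?k * ((2 ^ ?k - 1) * (of_nat ?k * ?b))) (1 / of_nat ?k * (of_nat ?k * G n))"
      using n by (intro pcong_scale Zp_divide_nat not_dvd_M(2)) auto
    then have 1: "pcong 2 ((2 ^ ?k - 1) * ?b) (G n)"
      using M by simp
    have "?v \<in> Zp"
      by (intro Zp_diff Zp_mult Zp_divide_numeral Zp_uminus Zp_numeral Zp_of_nat q(1)) simp_all
    from pcong_scale[OF 1 this] have 2: "pcong 2 (?v * ((2 ^ ?k - 1) * ?b)) (?v * G n)" .
    have "4 * (2 ^ ?k) = (1 + P * q) ^ n"
    proof -
      have "4 * (2 ^ ?k) = (2 :: rat) ^ (M n)"
        using M by (simp add: power_diff)
      then show ?thesis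
        by (simp only: M_def mult.commute[of n] power_mult q(2))
    qed
    then have "pcong 2 (4 * 2 ^ ?k - 4) (1 + P * q * of_nat n - 4)"
      using one_plus_P_power[OF q(1), of n] by (intro pcong_diff) auto
    then have "pcong 2 (?v / 4 * ?b * (4 * 2 ^ ?k - 4)) (?v / 4 * ?b * (1 + P * q * of_nat n - 4))"
      by (rule pcong_scale) (intro Zp_mult Zp_divide_numeral b \<open>?v \<in> Zp\<close>, simp)
    moreover have "v / 4 * b * (4 * t - 4) = v * ((t - 1) * b)" for v b t :: rat
      by (simp add: algebra_simps)
    ultimately have 3: "pcong 2 (?v * ((2 ^ ?k - 1) * ?b)) (?v / 4 * ?b * (1 + P * q * of_nat n - 4))"
      by (simp only:)
    have "pcong 2 (?v / 4 * ?b * (1 + P * q * of_nat n - 4)) ?b"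
    proof (rule pcongI)
      show "?v / 4 * ?b * (1 + P * q * of_nat n - 4) - ?b = P ^ 2 * (- (q * q * of_nat n * of_nat n * ?b) / 9)"
        by (simp add: field_simps power2_eq_square)
      show "- (q * q * of_nat n * of_nat n * ?b) / 9 \<in> Zp"
        by (intro Zp_divide_numeral Zp_mult Zp_uminus Zp_of_nat q(1) b) simp
    qed
    then show "pcong 2 ?b (?v * G n)"
      using 2 3 by (blast intro: pcong_trans pcong_sym)
  qed
qed

section \<open>The truncated logarithm\<close>

text \<open>The series of log (1 + x) up to degree 4, so the argument is the distance from
  1.\<close>

definition tlog :: "rat \<Rightarrow> rat" where
  "tlog x = x - x ^ 2 / 2 + x ^ 3 / 3 - x ^ 4 / 4"

text \<open>Additivity of the logarithm is a formal identity, so after truncation only terms of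
  degree at least 5 in u and v remain, each with a factor p^5. The remainder is written out in s = u
  + v and m = u v; its denominators 2, 3, 4 are units.\<close>

lemma tlog_mult:
  assumes "pcong 1 x 1" "pcong 1 y 1"
  shows "pcong 5 (tlog (x * y - 1)) (tlog (x - 1) + tlog (y - 1))"
proof -
  obtain u v where u: "u \<in> Zp" "x = 1 + P * u" and v: "v \<in> Zp" "y = 1 + P * v"
    using assms by (auto elim!: pcongE)
  define s m where "s = u + v" and "m = u * v"
  have sm: "s \<in> Zp" "m \<in> Zp"
    using u v by (auto simp: s_def m_def)
  have xy: "x * y - 1 = P * s + P ^ 2 * m"
    by (simp add: u v s_def m_def algebra_simps power2_eq_square)
  have "tlog (P * s + P ^ 2 * m) - (tlog (P * u) + tlog (P * v)) =
    P ^ 5 * (s * m ^ 2 + P * m ^ 3 / 3 - s ^ 3 * m - 3 * (P * s ^ 2 * m ^ 2) / 2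
      - P ^ 2 * s * m ^ 3 - P ^ 3 * m ^ 4 / 4)"
    unfolding tlog_def s_def m_def
    by (simp add: field_simps power2_eq_square power3_eq_cube power4_eq_xxxx eval_nat_numeral)
  moreover have "s * m ^ 2 + P * m ^ 3 / 3 - s ^ 3 * m - 3 * (P * s ^ 2 * m ^ 2) / 2
      - P ^ 2 * s * m ^ 3 - P ^ 3 * m ^ 4 / 4 \<in> Zp"
    using sm by (intro Zp_diff Zp_add) auto
  ultimately show ?thesis
    unfolding xy using u v by (intro pcongI) auto
qed

text \<open>The first conjunct keeps the partial products congruent to 1, as
  \<open>tlog_mult\<close> demands in the induction step.\<close>

lemma tlog_prod:
  assumes "finite A" "\<And>a. a \<in> A \<Longrightarrow> pcong 1 (f a) 1"
  shows "pcong 1 (prod f A) 1 \<and> pcong 5 (tlog (prod f A - 1)) (\<Sum>a\<in>A. tlog (f a - 1))"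
  using assms
proof (induction A rule: finite_induct)
  case empty
  then show ?case
    by (simp add: tlog_def)
next
  case (insert a A)
  then have IH: "pcong 1 (prod f A) 1" "pcong 5 (tlog (prod f A - 1)) (\<Sum>a\<in>A. tlog (f a - 1))"
    and fa: "pcong 1 (f a) 1"
    by auto
  have "pcong 1 (f a * prod f A) 1"
    using pcong_mult[OF fa IH(1)] pcong_Zp[OF fa] by simp
  moreover have "pcong 5 (tlog (f a * prod f A - 1)) (tlog (f a - 1) + (\<Sum>a\<in>A. tlog (f a - 1)))"
    using tlog_mult[OF fa IH(1)] pcong_add[OF pcong_refl[of 5 "tlog (f a - 1)"] IH(2)]
    by (rule pcong_trans)
  ultimately show ?case
    using insert by simp
qed

section \<open>The truncated exponential of the truncated logarithm\<close>

lemma tlog_Zp: "x \<in> Zp \<Longrightarrow> tlog x \<in> Zp"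
  unfolding tlog_def by auto

lemma pcong_power_mult_0:
  assumes "u \<in> Zp" "c \<in> Zp"
  shows "pcong r ((P * u) ^ r * c) 0"
  using assms by (intro pcongI[where z = "u ^ r * c"]) (auto simp: power_mult_distrib)

lemma pcong_power: "pcong r x y \<Longrightarrow> x \<in> Zp \<Longrightarrow> y \<in> Zp \<Longrightarrow> pcong r (x ^ n) (y ^ n)"
  by (induction n) (auto intro!: pcong_mult)

text \<open>The formal identity exp (log (1 + x)) = 1 + x holds up to degree 4 for the truncations,
  and x^5 is divisible by p^5.\<close>

lemma texp_tlog:
  assumes "u \<in> Zp"
  defines "x \<equiv> P * u"
  shows "pcong 5 (1 + tlog x + 1 / 2 * tlog x ^ 2 + 1 / 6 * tlog x ^ 3 + 1 / 24 * tlog x ^ 4) (1 + x)"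
proof -
  have x: "x \<in> Zp"
    using assms by simp
  \<comment> \<open>Each power of \<open>tlog x\<close> is computed from the truncation of the
    preceding one, with the multiple of x^5 split off explicitly.\<close>
  have sq: "tlog x ^ 2 = x ^ 2 - x ^ 3 + 11 * x ^ 4 / 12
      + x ^ 5 * (x / 4 + x / 3 / 3 - 5 / 6 - x ^ 2 / 6 + x ^ 3 / 4 / 4)"
    unfolding tlog_def by (simp add: field_simps eval_nat_numeral)
  have cube: "tlog x * (x ^ 2 - x ^ 3 + 11 * x ^ 4 / 12) = x ^ 3 - 3 * x ^ 4 / 2
      + x ^ 5 * (1 / 3 + 1 / 2 + 11 / 12 - x / 4 - x / 3 - 11 * x / 12 / 2 + x ^ 2 / 4
        + 11 * x ^ 2 / 12 / 3 - 11 * x ^ 3 / 12 / 4)"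
    unfolding tlog_def by (simp add: field_simps eval_nat_numeral)
  have fourth: "tlog x * (x ^ 3 - 3 * x ^ 4 / 2) = x ^ 4
      + x ^ 5 * (- 1 / 2 - 3 / 2 + x / 3 + 3 * x / 4 - x ^ 2 / 4 - x ^ 2 / 2 + 3 * x ^ 3 / 2 / 4)"
    unfolding tlog_def by (simp add: field_simps eval_nat_numeral)
  have drop: "pcong 5 (a + x ^ 5 * c) a" if "c \<in> Zp" for a c
    using pcong_add[OF pcong_refl pcong_power_mult_0[OF assms(1) that], of 5 a]
    by (simp add: x_def)
  have t2: "pcong 5 (tlog x ^ 2) (x ^ 2 - x ^ 3 + 11 * x ^ 4 / 12)"
    unfolding sq using x by (intro drop Zp_diff Zp_add) auto
  have "pcong 5 (tlog x ^ 3) (tlog x * (x ^ 2 - x ^ 3 + 11 * x ^ 4 / 12))"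
    using pcong_scale[OF t2 tlog_Zp[OF x]] by (simp add: eval_nat_numeral)
  also have "pcong 5 \<dots> (x ^ 3 - 3 * x ^ 4 / 2)"
    unfolding cube using x by (intro drop Zp_diff Zp_add) auto
  finally have t3: "pcong 5 (tlog x ^ 3) (x ^ 3 - 3 * x ^ 4 / 2)" .
  have "pcong 5 (tlog x ^ 4) (tlog x * (x ^ 3 - 3 * x ^ 4 / 2))"
    using pcong_scale[OF t3 tlog_Zp[OF x]] by (simp add: eval_nat_numeral)
  also have "pcong 5 \<dots> (x ^ 4)"
    unfolding fourth using x by (intro drop Zp_diff Zp_add) auto
  finally have t4: "pcong 5 (tlog x ^ 4) (x ^ 4)" .
  have "pcong 5 (1 + tlog x + 1 / 2 * tlog x ^ 2 + 1 / 6 * tlog x ^ 3 + 1 / 24 * tlog x ^ 4)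
      (1 + tlog x + 1 / 2 * (x ^ 2 - x ^ 3 + 11 * x ^ 4 / 12) + 1 / 6 * (x ^ 3 - 3 * x ^ 4 / 2)
        + 1 / 24 * x ^ 4)"
    by (intro pcong_add pcong_refl pcong_scale t2 t3 t4) auto
  also have "(1 + tlog x + 1 / 2 * (x ^ 2 - x ^ 3 + 11 * x ^ 4 / 12) + 1 / 6 * (x ^ 3 - 3 * x ^ 4 / 2)
        + 1 / 24 * x ^ 4) = 1 + x"
    by (simp add: tlog_def field_simps)
  finally show ?thesis .
qed

section \<open>The logarithm of the Wilson quotient and power sums\<close>

lemma wilson_quotient_eq: "fact (p - 1) = - 1 + P * wilson_quotient p"
  by (simp add: wilson_quotient_def)

lemma wilson_quotient_Zp: "wilson_quotient p \<in> Zp"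
proof -
  obtain z where "fact (p - 1) = - 1 + P * z" "z \<in> Zp"
    using wilson by (rule pcongE) auto
  then show ?thesis
    by (simp add: wilson_quotient_def)
qed

lemma tlog_wilson_quotient:
  "pcong 5 ((P - 1) * tlog (- (P * wilson_quotient p)))
    (4 * powsum (M 1) - 3 * powsum (M 2) + 4 / 3 * powsum (M 3) - 1 / 4 * powsum (M 4)
      - 25 / 12 * (P - 1))"
proof -
  let ?w = "1 - P * wilson_quotient p"
  have w: "pcong 1 ?w 1"
    using wilson_quotient_Zp by (intro pcongI[where z = "- wilson_quotient p"]) auto
  have even: "even (p - 1)"
    using p_eq_half by (metis add_diff_cancel_right' dvd_triv_left)
  have "(\<Prod>a\<in>{1..<p}. of_nat a ^ (p - 1)) = (fact (p - 1) :: rat) ^ (p - 1)"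
  proof -
    have "{1..<p} = {1..p - 1}"
      using ge7 by auto
    then show ?thesis
      by (simp add: fact_prod prod_power_distrib)
  qed
  \<comment> \<open>The exponent p - 1 is even, so -1 + p W may be replaced by 1 - p W, which is
    congruent to 1 modulo p.\<close>
  also have "\<dots> = ?w ^ (p - 1)"
    unfolding wilson_quotient_eq using power_minus_even[OF even, of ?w] by simp
  also have "\<dots> = (\<Prod>a\<in>{1..<p}. ?w)"
    by simp
  finally have prods: "(\<Prod>a\<in>{1..<p}. ?w) = (\<Prod>a\<in>{1..<p}. of_nat a ^ (p - 1))"
    by simp
  have "pcong 5 (tlog ((\<Prod>a\<in>{1..<p}. ?w) - 1)) (\<Sum>a\<in>{1..<p}. tlog (?w - 1))"
    using tlog_prod[of "{1..<p}" "\<lambda>a. ?w"] w by blast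
  moreover have "pcong 5 (tlog ((\<Prod>a\<in>{1..<p}. of_nat a ^ (p - 1)) - 1))
      (\<Sum>a\<in>{1..<p}. tlog (of_nat a ^ (p - 1) - 1))"
    using tlog_prod[of "{1..<p}" "\<lambda>a. of_nat a ^ (p - 1)"] fermat not_dvd_range by blast
  ultimately have "pcong 5 (\<Sum>a\<in>{1..<p}. tlog (?w - 1)) (\<Sum>a\<in>{1..<p}. tlog (of_nat a ^ (p - 1) - 1))"
    unfolding prods by (blast intro: pcong_trans pcong_sym)
  moreover have "(\<Sum>a\<in>{1..<p}. tlog (?w - 1)) = (P - 1) * tlog (- (P * wilson_quotient p))"
    using ge7 by (simp add: of_nat_diff)
  \<comment> \<open>In powers of y the coefficient of y^n is (-1)^(n-1) (4 choose n) / n, and 25/12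
    = 1 + 1/2 + 1/3 + 1/4.\<close>
  moreover have "tlog (y - 1) = 4 * y ^ 1 - 3 * y ^ 2 + 4 / 3 * y ^ 3 - 1 / 4 * y ^ 4 - 25 / 12" for y
    unfolding tlog_def by (simp add: field_simps eval_nat_numeral)
  then have "(\<Sum>a\<in>{1..<p}. tlog (of_nat a ^ (p - 1) - 1)) =
    4 * powsum (M 1) - 3 * powsum (M 2) + 4 / 3 * powsum (M 3) - 1 / 4 * powsum (M 4)
      - 25 / 12 * (P - 1)"
    using ge7 unfolding powsum_M
    by (simp add: sum.distrib sum_subtractf sum_distrib_left of_nat_diff)
  ultimately show ?thesis
    by (simp only:)
qed

text \<open>By Fermat p^r divides (a^(p-1) - 1)^r. Expanding binomially and summing over a gives an
  alternating sum of power sums.\<close>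

lemma powsum_M_differences:
  "pcong 2 (powsum (M 2) - 2 * powsum (M 1) + (P - 1)) 0"
  "pcong 3 (powsum (M 3) - 3 * powsum (M 2) + 3 * powsum (M 1) - (P - 1)) 0"
  "pcong 4 (powsum (M 4) - 4 * powsum (M 3) + 6 * powsum (M 2) - 4 * powsum (M 1) + (P - 1)) 0"
proof -
  have *: "pcong r (\<Sum>a\<in>{1..<p}. (of_nat a ^ (p - 1) - 1) ^ r) 0" for r
  proof -
    have "pcong r (\<Sum>a\<in>{1..<p}. (of_nat a ^ (p - 1) - 1) ^ r) (\<Sum>a\<in>{1..<p}. 0)"
    proof (rule pcong_sum)
      fix a assume "a \<in> {1..<p}"
      then obtain q where "q \<in> Zp" "of_nat a ^ (p - 1) = 1 + P * q"
        using fermat[OF not_dvd_range, of a] by (auto elim: pcongE)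
      then show "pcong r ((of_nat a ^ (p - 1) - 1) ^ r) 0"
        using pcong_power_mult_0[of q 1 r] by simp
    qed
    then show ?thesis
      by simp
  qed
  have c: "P - 1 = (\<Sum>a\<in>{1..<p}. 1)"
    using ge7 by (simp add: of_nat_diff)
  have "(y - 1) ^ 2 = y ^ 2 - 2 * y ^ 1 + 1" for y :: rat
    by (simp add: eval_nat_numeral algebra_simps)
  then show "pcong 2 (powsum (M 2) - 2 * powsum (M 1) + (P - 1)) 0"
    using *[of 2] unfolding powsum_M c by (simp add: sum.distrib sum_subtractf sum_distrib_left)
  have "(y - 1) ^ 3 = y ^ 3 - 3 * y ^ 2 + 3 * y ^ 1 - 1" for y :: rat
    by (simp add: eval_nat_numeral algebra_simps)
  then show "pcong 3 (powsum (M 3) - 3 * powsum (M 2) + 3 * powsum (M 1) - (P - 1)) 0"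
    using *[of 3] unfolding powsum_M c by (simp add: sum.distrib sum_subtractf sum_distrib_left)
  have "(y - 1) ^ 4 = y ^ 4 - 4 * y ^ 3 + 6 * y ^ 2 - 4 * y ^ 1 + 1" for y :: rat
    by (simp add: eval_nat_numeral algebra_simps)
  then show "pcong 4 (powsum (M 4) - 4 * powsum (M 3) + 6 * powsum (M 2) - 4 * powsum (M 1) + (P - 1)) 0"
    using *[of 4] unfolding powsum_M c by (simp add: sum.distrib sum_subtractf sum_distrib_left)
qed

section \<open>The congruence for the Wilson quotient\<close>

text \<open>The value \<open>Bbar2 p n\<close> occurs with a factor p^3, so knowing it modulo p^2
  suffices. The same \<alpha> and \<beta> serve all n from 1 to 4, and the unit p - 1 is factored
  out.\<close>

lemma powsum_M_expansion:
  obtains \<alpha> \<beta> where "\<alpha> \<in> Zp" "\<beta> \<in> Zp"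
    "\<And>n. n \<in> {1..4} \<Longrightarrow> pcong 2 (Bbar2 p n) (\<alpha> + P * \<beta> * of_nat n)"
    "\<And>n. n \<in> {1..4} \<Longrightarrow> pcong 5 (powsum (M n))
      ((P - 1) * (1 + P * (of_nat n * Bbar p n) + P ^ 3 / 6 * (of_nat n *
        (of_nat n * (P - 1) - 1) * (of_nat n * (P - 1) - 2) * (\<alpha> + P * \<beta> * of_nat n))))"
proof -
  obtain \<alpha> \<beta> where ab: "\<alpha> \<in> Zp" "\<beta> \<in> Zp"
    "\<And>n. n \<in> {1..4} \<Longrightarrow> pcong 2 (Bbar2 p n) (\<alpha> + P * \<beta> * of_nat n)"
    using Kummer_Bbar2 by (rule affine_modE) blast
  have "pcong 5 (powsum (M n))
      ((P - 1) * (1 + P * (of_nat n * Bbar p n) + P ^ 3 / 6 * (of_nat n *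
        (of_nat n * (P - 1) - 1) * (of_nat n * (P - 1) - 2) * (\<alpha> + P * \<beta> * of_nat n))))"
    if n: "n \<in> {1..4}" for n
  proof -
    let ?m = "of_nat n * (P - 1)"
    let ?c = "?m * (?m - 1) * (?m - 2) / 6"
    have "?c \<in> Zp"
      by (intro Zp_intros) simp
    then have "pcong 2 (?c * Bbar2 p n) (?c * (\<alpha> + P * \<beta> * of_nat n))"
      using ab(3)[OF n] by (rule pcong_scale[rotated])
    then have "pcong (2 + 3) (P ^ 3 * (?c * Bbar2 p n)) (P ^ 3 * (?c * (\<alpha> + P * \<beta> * of_nat n)))"
      by (simp only: pcong_P_mult)
    then have "pcong 5 (P - 1 + P * (?m * Bbar p n) + P ^ 3 * (?c * Bbar2 p n))
        (P - 1 + P * (?m * Bbar p n) + P ^ 3 * (?c * (\<alpha> + P * \<beta> * of_nat n)))"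
      by (intro pcong_add pcong_refl) simp
    moreover have "pcong 5 (powsum (M n))
        (P - 1 + P * (?m * Bbar p n) + P ^ 3 * (?c * Bbar2 p n))"
      using powsum_cong_5[of n] n unfolding of_nat_M by (simp add: mult.assoc)
    ultimately have "pcong 5 (powsum (M n))
        (P - 1 + P * (?m * Bbar p n) + P ^ 3 * (?c * (\<alpha> + P * \<beta> * of_nat n)))"
      by (blast intro: pcong_trans)
    also have "P - 1 + P * (?m * Bbar p n) + P ^ 3 * (?c * (\<alpha> + P * \<beta> * of_nat n))
        = (P - 1) * (1 + P * (of_nat n * Bbar p n) + P ^ 3 / 6 * (of_nat n *
        (?m - 1) * (?m - 2) * (\<alpha> + P * \<beta> * of_nat n)))"
      by (simp add: field_simps)
    finally show ?thesis .
  qed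
  with ab show thesis
    by (rule that)
qed

lemma inverse_P_minus_1: "1 / (P - 1) \<in> Zp"
  using Zp_divide_nat[of 1 "p - 1"] not_dvd_less[of "p - 1"] ge7 by (simp add: of_nat_diff)

text \<open>Serves to extract a difference of the \<open>Bbar p n\<close> from one of power sums:
  the multiple of p^s is dropped, then the units p - 1 and c and one factor p are cancelled.\<close>

lemma pcong_cancel_0:
  assumes "pcong s y 0" "y = (P - 1) * (c * (P * x)) + P ^ s * z"
    "z \<in> Zp" "1 / c \<in> Zp" "c \<noteq> 0" "s = r + 1"
  shows "pcong r x 0"
proof -
  have "pcong (r + 1) ((P - 1) * (c * (P * x)) + P ^ (r + 1) * z - P ^ (r + 1) * z) (0 - 0)"
    using assms by (intro pcong_diff) (auto simp: pcong_0_iff)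
  then have "pcong (r + 1) ((1 / c * (1 / (P - 1))) * ((P - 1) * (c * (P * x)))) ((1 / c * (1 / (P - 1))) * 0)"
    using inverse_P_minus_1 assms by (intro pcong_scale Zp_mult) auto
  moreover have "P - 1 \<noteq> 0"
    using ge7 by simp
  ultimately have "pcong (r + 1) (P ^ 1 * x) (P ^ 1 * 0)"
    using assms by simp
  then show ?thesis
    by (simp only: pcong_P_mult)
qed

section \<open>Differences of the numbers \<open>Bbar p n\<close>\<close>

context
  fixes \<alpha> \<beta> :: rat
  assumes ab: "\<alpha> \<in> Zp" "\<beta> \<in> Zp"
    and exp: "\<And>n. n \<in> {1..4} \<Longrightarrow> pcong 5 (powsum (M n))
      ((P - 1) * (1 + P * (of_nat n * Bbar p n) + P ^ 3 / 6 * (of_nat n *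
        (of_nat n * (P - 1) - 1) * (of_nat n * (P - 1) - 2) * (\<alpha> + P * \<beta> * of_nat n))))"
begin

lemma powsum_expansion:
  "pcong 5 (powsum (M 1)) ((P - 1) * (1 + P * Bbar p 1
      + P ^ 3 / 6 * ((P - 2) * (P - 3) * (\<alpha> + P * \<beta>))))"
  "pcong 5 (powsum (M 2)) ((P - 1) * (1 + P * (2 * Bbar p 2)
      + P ^ 3 / 6 * (2 * (2 * P - 3) * (2 * P - 4) * (\<alpha> + P * \<beta> * 2))))"
  "pcong 5 (powsum (M 3)) ((P - 1) * (1 + P * (3 * Bbar p 3)
      + P ^ 3 / 6 * (3 * (3 * P - 4) * (3 * P - 5) * (\<alpha> + P * \<beta> * 3))))"
  "pcong 5 (powsum (M 4)) ((P - 1) * (1 + P * (4 * Bbar p 4)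
      + P ^ 3 / 6 * (4 * (4 * P - 5) * (4 * P - 6) * (\<alpha> + P * \<beta> * 4))))"
  using exp[of 1] exp[of 2] exp[of 3] exp[of 4] by (simp_all add: algebra_simps)

text \<open>As n (k+1 choose n) = (k + 1) (k choose n - 1), the (k+1)-st difference of
  \<open>of_nat n * Bbar p n\<close> from n = 0 is k + 1 times the k-th difference of
  \<open>Bbar p n\<close> from n = 1. The next two lemmas rest on the same identity.\<close>

lemma Bbar_difference_1: "pcong 1 (Bbar p 2 - Bbar p 1) 0"
proof -
  note e = powsum_expansion[THEN pcong_mono]
  have "pcong 2 (powsum (M 2) - 2 * powsum (M 1) + (P - 1))
     (((P - 1) * (1 + P * (2 * Bbar p 2)
        + P ^ 3 / 6 * (2 * (2 * P - 3) * (2 * P - 4) * (\<alpha> + P * \<beta> * 2))))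
      - 2 * ((P - 1) * (1 + P * Bbar p 1 + P ^ 3 / 6 * ((P - 2) * (P - 3) * (\<alpha> + P * \<beta>)))) + (P - 1))"
    (is "pcong 2 _ ?R")
    by (intro pcong_add pcong_diff pcong_scale e pcong_refl) auto
  then have "pcong 2 ?R 0"
    by (rule pcong_trans[OF pcong_sym powsum_M_differences(1)])
  moreover have "?R = (P - 1) * (2 * (P * (Bbar p 2 - Bbar p 1))) + P ^ 2 * (P * ((P - 1) *
      (2 * (2 * P - 3) * (2 * P - 4) * (\<alpha> + P * \<beta> * 2) - 2 * ((P - 2) * (P - 3) * (\<alpha> + P * \<beta>)))) / 6)"
    by (simp add: field_simps power2_eq_square power3_eq_cube)
  ultimately show ?thesis
    by (rule pcong_cancel_0) ((intro Zp_intros ab; simp)+, simp_all)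
qed

lemma Bbar_difference_2: "pcong 2 (Bbar p 3 - 2 * Bbar p 2 + Bbar p 1) 0"
proof -
  note e = powsum_expansion[THEN pcong_mono]
  have "pcong 3 (powsum (M 3) - 3 * powsum (M 2) + 3 * powsum (M 1) - (P - 1))
     ((P - 1) * (1 + P * (3 * Bbar p 3)
        + P ^ 3 / 6 * (3 * (3 * P - 4) * (3 * P - 5) * (\<alpha> + P * \<beta> * 3)))
      - 3 * ((P - 1) * (1 + P * (2 * Bbar p 2)
        + P ^ 3 / 6 * (2 * (2 * P - 3) * (2 * P - 4) * (\<alpha> + P * \<beta> * 2))))
      + 3 * ((P - 1) * (1 + P * Bbar p 1
        + P ^ 3 / 6 * ((P - 2) * (P - 3) * (\<alpha> + P * \<beta>)))) - (P - 1))"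
    (is "pcong 3 _ ?R")
    by (intro pcong_add pcong_diff pcong_scale e pcong_refl) auto
  then have "pcong 3 ?R 0"
    by (rule pcong_trans[OF pcong_sym powsum_M_differences(2)])
  moreover have "?R = (P - 1) * (3 * (P * (Bbar p 3 - 2 * Bbar p 2 + Bbar p 1))) + P ^ 3 * ((P - 1) *
      (3 * (3 * P - 4) * (3 * P - 5) * (\<alpha> + P * \<beta> * 3)
        - 3 * (2 * (2 * P - 3) * (2 * P - 4) * (\<alpha> + P * \<beta> * 2))
        + 3 * ((P - 2) * (P - 3) * (\<alpha> + P * \<beta>))) / 6)"
    by (simp add: field_simps power2_eq_square power3_eq_cube)
  ultimately show ?thesis
    by (rule pcong_cancel_0) ((intro Zp_intros ab; simp)+, simp_all)
qed

lemma Bbar_difference_3: "pcong 3 (Bbar p 4 - 3 * Bbar p 3 + 3 * Bbar p 2 - Bbar p 1) 0"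
proof -
  note e = powsum_expansion[THEN pcong_mono]
  have "pcong 4 (powsum (M 4) - 4 * powsum (M 3) + 6 * powsum (M 2) - 4 * powsum (M 1) + (P - 1))
     ((P - 1) * (1 + P * (4 * Bbar p 4)
        + P ^ 3 / 6 * (4 * (4 * P - 5) * (4 * P - 6) * (\<alpha> + P * \<beta> * 4)))
      - 4 * ((P - 1) * (1 + P * (3 * Bbar p 3)
        + P ^ 3 / 6 * (3 * (3 * P - 4) * (3 * P - 5) * (\<alpha> + P * \<beta> * 3))))
      + 6 * ((P - 1) * (1 + P * (2 * Bbar p 2)
        + P ^ 3 / 6 * (2 * (2 * P - 3) * (2 * P - 4) * (\<alpha> + P * \<beta> * 2))))
      - 4 * ((P - 1) * (1 + P * Bbar p 1
        + P ^ 3 / 6 * ((P - 2) * (P - 3) * (\<alpha> + P * \<beta>)))) + (P - 1))"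
    (is "pcong 4 _ ?R")
    by (intro pcong_add pcong_diff pcong_scale e pcong_refl) auto
  then have "pcong 4 ?R 0"
    by (rule pcong_trans[OF pcong_sym powsum_M_differences(3)])
  \<comment> \<open>The p^3 correction alone would not vanish modulo p^4. However, its \<alpha>-part
    is a cubic polynomial in n, killed by the fourth difference, and its \<beta>-part carries
    another p.\<close>
  moreover have "?R = (P - 1) * (4 * (P * (Bbar p 4 - 3 * Bbar p 3 + 3 * Bbar p 2 - Bbar p 1)))
      + P ^ 4 * (4 * (P - 1) ^ 3 * \<beta>)"
    by (simp add: field_simps power2_eq_square power3_eq_cube power4_eq_xxxx)
  ultimately show ?thesis
    by (rule pcong_cancel_0) ((intro Zp_intros ab; simp)+, simp_all)
qed

lemma tlog_wilson_quotient_Bbar: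
  "pcong 5 (tlog (- (P * wilson_quotient p)))
    (P * (4 * Bbar p 1 - 6 * Bbar p 2 + 4 * Bbar p 3 - Bbar p 4) + P ^ 3 * (\<alpha> / 3))"
proof -
  note e = powsum_expansion
  have "pcong 5 (4 * powsum (M 1) - 3 * powsum (M 2) + 4 / 3 * powsum (M 3) - 1 / 4 * powsum (M 4)
      - 25 / 12 * (P - 1))
     (4 * ((P - 1) * (1 + P * Bbar p 1
        + P ^ 3 / 6 * ((P - 2) * (P - 3) * (\<alpha> + P * \<beta>))))
      - 3 * ((P - 1) * (1 + P * (2 * Bbar p 2)
        + P ^ 3 / 6 * (2 * (2 * P - 3) * (2 * P - 4) * (\<alpha> + P * \<beta> * 2))))
      + 4 / 3 * ((P - 1) * (1 + P * (3 * Bbar p 3)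
        + P ^ 3 / 6 * (3 * (3 * P - 4) * (3 * P - 5) * (\<alpha> + P * \<beta> * 3))))
      - 1 / 4 * ((P - 1) * (1 + P * (4 * Bbar p 4)
        + P ^ 3 / 6 * (4 * (4 * P - 5) * (4 * P - 6) * (\<alpha> + P * \<beta> * 4))))
      - 25 / 12 * (P - 1))"
    (is "pcong 5 _ ?R")
    by (intro pcong_add pcong_diff pcong_scale e pcong_refl) auto
  with tlog_wilson_quotient have "pcong 5 ((P - 1) * tlog (- (P * wilson_quotient p))) ?R"
    by (rule pcong_trans)
  \<comment> \<open>With the weights (-1)^(n-1) (4 choose n) / n, a sequence n f(n) with f of degree
    at most 3 sums to f(0). The p^3 correction has f(0) = 2 \<alpha>, so \<beta> disappears, and the
    constants add up to 25/12.\<close>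
  also have "?R = (P - 1) * (P * (4 * Bbar p 1 - 6 * Bbar p 2 + 4 * Bbar p 3 - Bbar p 4) + P ^ 3 * (\<alpha> / 3))"
    by (simp add: field_simps power2_eq_square power3_eq_cube power4_eq_xxxx)
  finally have "pcong 5 (1 / (P - 1) * ((P - 1) * tlog (- (P * wilson_quotient p))))
      (1 / (P - 1) * ((P - 1) * (P * (4 * Bbar p 1 - 6 * Bbar p 2 + 4 * Bbar p 3 - Bbar p 4) + P ^ 3 * (\<alpha> / 3))))"
    using inverse_P_minus_1 by (rule pcong_scale)
  moreover have "P - 1 \<noteq> 0"
    using ge7 by simp
  ultimately show ?thesis
    by simp
qed

end

text \<open>The truncated exponential inverts the truncated logarithm modulo \<open>p\<^sup>5\<close>.\<close>

lemma wilson_quotient_from_tlog: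
  assumes l: "l \<in> Zp" "pcong 5 (tlog (- (P * wilson_quotient p))) (P * l)"
  shows "pcong 4 (wilson_quotient p) 
    (- (l + 1 / 2 * (P ^ 1 * l ^ 2) + 1 / 6 * (P ^ 2 * l ^ 3) + 1 / 24 * (P ^ 3 * l ^ 4)))"
proof -
  let ?W = "wilson_quotient p"
  let ?t = "tlog (- (P * ?W))"
  have t: "?t \<in> Zp" "P * l \<in> Zp"
    using wilson_quotient_Zp l(1) by (auto intro!: tlog_Zp)
  have W: "P * - ?W = - (P * ?W)"
    by simp
  have "pcong 5 (1 + - (P * ?W)) (1 + ?t + 1 / 2 * ?t ^ 2 + 1 / 6 * ?t ^ 3 + 1 / 24 * ?t ^ 4)"
    using pcong_sym[OF texp_tlog[OF Zp_uminus[OF wilson_quotient_Zp]]] unfolding W .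
  also have "pcong 5 (1 + ?t + 1 / 2 * ?t ^ 2 + 1 / 6 * ?t ^ 3 + 1 / 24 * ?t ^ 4)
      (1 + P * l + 1 / 2 * (P * l) ^ 2 + 1 / 6 * (P * l) ^ 3 + 1 / 24 * (P * l) ^ 4)"
    by (intro pcong_add pcong_scale pcong_power pcong_refl l t) auto
  finally have "pcong 5 (1 - (1 + - (P * ?W)))
      (1 - (1 + P * l + 1 / 2 * (P * l) ^ 2 + 1 / 6 * (P * l) ^ 3 + 1 / 24 * (P * l) ^ 4))"
    by (rule pcong_diff[OF pcong_refl])
  moreover have "1 - (1 + - (P * ?W)) = P ^ 1 * ?W"
    by simp
  moreover have "1 - (1 + P * l + 1 / 2 * (P * l) ^ 2 + 1 / 6 * (P * l) ^ 3 + 1 / 24 * (P * l) ^ 4)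
      = P ^ 1 * (- (l + 1 / 2 * (P ^ 1 * l ^ 2) + 1 / 6 * (P ^ 2 * l ^ 3) + 1 / 24 * (P ^ 3 * l ^ 4)))"
    by (simp add: field_simps eval_nat_numeral)
  ultimately have "pcong (4 + 1) (P ^ 1 * ?W)
      (P ^ 1 * (- (l + 1 / 2 * (P ^ 1 * l ^ 2) + 1 / 6 * (P ^ 2 * l ^ 3) + 1 / 24 * (P ^ 3 * l ^ 4))))"
    by simp
  then show ?thesis
    by (simp only: pcong_P_mult)
qed

lemma wilson_quotient_cong:
  "pcong 4 (wilson_quotient p) (- 4 * Bbar p 1 + 6 * Bbar p 2 - 4 * Bbar p 3 + Bbar p 4
     + P * (- 3 * Bbar p 1 ^ 2 + 4 * Bbar p 1 * Bbar p 2 - Bbar p 1 * Bbar p 3 - 1 / 2 * Bbar p 2 ^ 2)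
     + P ^ 2 * (- (2 / 3) * Bbar p 1 ^ 3 + 1 / 2 * Bbar p 1 ^ 2 * Bbar p 2
       - 2 / 3 * Bbar2 p 1 + 1 / 3 * Bbar2 p 2)
     - P ^ 3 * (1 / 24 * Bbar p 1 ^ 4 + 1 / 3 * Bbar p 1 * Bbar2 p 1))"
proof -
  obtain \<alpha> \<beta> where ab: "\<alpha> \<in> Zp" "\<beta> \<in> Zp"
    and lin: "\<And>n. n \<in> {1..4} \<Longrightarrow> pcong 2 (Bbar2 p n) (\<alpha> + P * \<beta> * of_nat n)"
    and exp: "\<And>n. n \<in> {1..4} \<Longrightarrow> pcong 5 (powsum (M n))
      ((P - 1) * (1 + P * (of_nat n * Bbar p n) + P ^ 3 / 6 * (of_nat n *
        (of_nat n * (P - 1) - 1) * (of_nat n * (P - 1) - 2) * (\<alpha> + P * \<beta> * of_nat n))))"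
    using powsum_M_expansion by blast
  define b1 b2 where "b1 = Bbar2 p 1" and "b2 = Bbar2 p 2"
  obtain w1 where w1: "b1 = \<alpha> + P * \<beta> + P ^ 2 * w1" "w1 \<in> Zp"
    using lin[of 1] by (auto simp: b1_def elim: pcongE)
  obtain w2 where w2: "b2 = \<alpha> + P * \<beta> * 2 + P ^ 2 * w2" "w2 \<in> Zp"
    using lin[of 2] by (auto simp: b2_def elim: pcongE)
  \<comment> \<open>The linear extrapolation 2 b1 - b2 of \<open>Bbar2 p n\<close> to n = 0 recovers
    \<alpha> modulo p^2.\<close>
  define c where "c = (2 * b1 - b2) / 3"
  have c: "c = \<alpha> / 3 + P ^ 2 * ((2 * w1 - w2) / 3)" "c \<in> Zp"
  proof -
    show "c = \<alpha> / 3 + P ^ 2 * ((2 * w1 - w2) / 3)"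
      unfolding c_def w1(1) w2(1) by (simp add: field_simps)
    then show "c \<in> Zp"
      by (simp only:) (intro Zp_intros ab w1 w2; simp)
  qed
  define x where "x = Bbar p 1"
  have x: "x \<in> Zp"
    unfolding x_def by (rule Bbar_Zp) simp
  \<comment> \<open>Newton interpolation from n = 1: the successive differences of
    \<open>Bbar p n\<close> are p d, p^2 e and p^3 f.\<close>
  obtain d where d: "Bbar p 2 = x + P * d" "d \<in> Zp"
  proof -
    obtain z where "Bbar p 2 - x = 0 + P ^ 1 * z" "z \<in> Zp"
      using Bbar_difference_1[OF ab exp] unfolding x_def by (rule pcongE)
    then show thesis
      by (intro that[of z]) (simp_all add: algebra_simps)
  qed
  obtain e where e: "Bbar p 3 = x + 2 * P * d + P ^ 2 * e" "e \<in> Zp"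
  proof -
    obtain z where "Bbar p 3 - 2 * Bbar p 2 + x = 0 + P ^ 2 * z" "z \<in> Zp"
      using Bbar_difference_2[OF ab exp] unfolding x_def by (rule pcongE)
    then show thesis
      by (intro that[of z]) (simp_all add: d(1) algebra_simps)
  qed
  obtain f where f: "Bbar p 4 = x + 3 * P * d + 3 * P ^ 2 * e + P ^ 3 * f" "f \<in> Zp"
  proof -
    obtain z where "Bbar p 4 - 3 * Bbar p 3 + 3 * Bbar p 2 - x = 0 + P ^ 3 * z" "z \<in> Zp"
      using Bbar_difference_3[OF ab exp] unfolding x_def by (rule pcongE)
    then show thesis
      by (intro that[of z]) (simp_all add: d(1) e(1) algebra_simps)
  qed
  \<comment> \<open>In Newton form, 4 B1 - 6 B2 + 4 B3 - B4 is x - p d + p^2 e - p^3 f; the summand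
    p^2 c stands for the correction \<alpha> / 3.\<close>
  define l where "l = x - P * d + P ^ 2 * (e + c) - P ^ 3 * f"
  have l: "l \<in> Zp"
    unfolding l_def by (intro Zp_intros x d(2) e(2) f(2) c(2))
  have "pcong 5 (tlog (- (P * wilson_quotient p)))
      (P * (4 * x - 6 * Bbar p 2 + 4 * Bbar p 3 - Bbar p 4) + P ^ 3 * (\<alpha> / 3))"
    using tlog_wilson_quotient_Bbar[OF ab exp] by (simp add: x_def)
  also have "pcong 5 \<dots> (P * l)"
  proof (rule pcongI)
    show "P * (4 * x - 6 * Bbar p 2 + 4 * Bbar p 3 - Bbar p 4) + P ^ 3 * (\<alpha> / 3) - P * l
      = P ^ 5 * (- ((2 * w1 - w2) / 3))"
      unfolding l_def c(1) d(1) e(1) f(1) by (simp add: field_simps eval_nat_numeral)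
    show "- ((2 * w1 - w2) / 3) \<in> Zp"
      by (intro Zp_intros w1(2) w2(2)) simp
  qed
  finally have W: "pcong 4 (wilson_quotient p)
    (- (l + 1 / 2 * (P ^ 1 * l ^ 2) + 1 / 6 * (P ^ 2 * l ^ 3) + 1 / 24 * (P ^ 3 * l ^ 4)))"
    by (rule wilson_quotient_from_tlog[OF l])
  \<comment> \<open>The power l^k is multiplied by p^(k-1), so modulo p^4 it is needed only modulo
    p^(5-k).\<close>
  have l1: "pcong 1 l x"
    by (rule pcongI[where z = "- d + P * (e + c) - P ^ 2 * f"])
      (simp add: l_def algebra_simps eval_nat_numeral, intro Zp_intros d(2) e(2) f(2) c(2))
  have l2: "pcong 2 l (x - P * d)"
    by (rule pcongI[where z = "e + c - P * f"])
      (simp add: l_def algebra_simps eval_nat_numeral, intro Zp_intros d(2) e(2) f(2) c(2))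
  have l3: "pcong 3 l (x - P * d + P ^ 2 * (e + c))"
    by (rule pcongI[where z = "- f"])
      (simp add: l_def algebra_simps eval_nat_numeral, intro Zp_intros d(2) e(2) f(2) c(2))
  have l4: "pcong 4 l (x - P * d + P ^ 2 * (e + c) - P ^ 3 * f)"
    unfolding l_def by (rule pcong_refl)
  have "pcong 1 (l ^ 4) (x ^ 4)"
    using l1 l x by (rule pcong_power)
  then have q4: "pcong 4 (P ^ 3 * l ^ 4) (P ^ 3 * x ^ 4)"
    by (rule pcong_P_multI) simp
  have "pcong 2 (l ^ 3) ((x - P * d) ^ 3)"
    by (intro pcong_power l2 l Zp_intros x d(2))
  also have "pcong 2 \<dots> (x ^ 3 - 3 * P * x ^ 2 * d)"
    by (rule pcongI[where z = "3 * x * d ^ 2 - P * d ^ 3"])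
      (simp add: algebra_simps eval_nat_numeral, intro Zp_intros x d(2))
  finally have q3: "pcong 4 (P ^ 2 * l ^ 3) (P ^ 2 * (x ^ 3 - 3 * P * x ^ 2 * d))"
    by (rule pcong_P_multI) simp
  have "pcong 3 (l ^ 2) ((x - P * d + P ^ 2 * (e + c)) ^ 2)"
    by (intro pcong_power l3 l Zp_intros x d(2) e(2) c(2))
  also have "pcong 3 \<dots> (x ^ 2 - 2 * P * x * d + P ^ 2 * d ^ 2 + 2 * P ^ 2 * x * (e + c))"
    by (rule pcongI[where z = "P * (e + c) ^ 2 - 2 * d * (e + c)"])
      (simp add: algebra_simps eval_nat_numeral, intro Zp_intros x d(2) e(2) c(2))
  finally have q2: "pcong 4 (P ^ 1 * l ^ 2)
      (P ^ 1 * (x ^ 2 - 2 * P * x * d + P ^ 2 * d ^ 2 + 2 * P ^ 2 * x * (e + c)))"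
    by (rule pcong_P_multI) simp
  note W
  also have "pcong 4 (- (l + 1 / 2 * (P ^ 1 * l ^ 2) + 1 / 6 * (P ^ 2 * l ^ 3) + 1 / 24 * (P ^ 3 * l ^ 4)))
    (- ((x - P * d + P ^ 2 * (e + c) - P ^ 3 * f)
      + 1 / 2 * (P ^ 1 * (x ^ 2 - 2 * P * x * d + P ^ 2 * d ^ 2 + 2 * P ^ 2 * x * (e + c)))
      + 1 / 6 * (P ^ 2 * (x ^ 3 - 3 * P * x ^ 2 * d)) + 1 / 24 * (P ^ 3 * x ^ 4)))"
    by (intro pcong_uminus pcong_add l4 pcong_scale[OF q2] pcong_scale[OF q3] pcong_scale[OF q4])
      simp_all
  also have "pcong 4 \<dots> (- 4 * x + 6 * Bbar p 2 - 4 * Bbar p 3 + Bbar p 4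
     + P * (- 3 * x ^ 2 + 4 * x * Bbar p 2 - x * Bbar p 3 - 1 / 2 * Bbar p 2 ^ 2)
     + P ^ 2 * (- (2 / 3) * x ^ 3 + 1 / 2 * x ^ 2 * Bbar p 2 - 2 / 3 * b1 + 1 / 3 * b2)
     - P ^ 3 * (1 / 24 * x ^ 4 + 1 / 3 * x * b1))"
  proof (rule pcongI)
    show "- ((x - P * d + P ^ 2 * (e + c) - P ^ 3 * f)
      + 1 / 2 * (P ^ 1 * (x ^ 2 - 2 * P * x * d + P ^ 2 * d ^ 2 + 2 * P ^ 2 * x * (e + c)))
      + 1 / 6 * (P ^ 2 * (x ^ 3 - 3 * P * x ^ 2 * d)) + 1 / 24 * (P ^ 3 * x ^ 4))
     - (- 4 * x + 6 * Bbar p 2 - 4 * Bbar p 3 + Bbar p 4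
     + P * (- 3 * x ^ 2 + 4 * x * Bbar p 2 - x * Bbar p 3 - 1 / 2 * Bbar p 2 ^ 2)
     + P ^ 2 * (- (2 / 3) * x ^ 3 + 1 / 2 * x ^ 2 * Bbar p 2 - 2 / 3 * b1 + 1 / 3 * b2)
     - P ^ 3 * (1 / 24 * x ^ 4 + 1 / 3 * x * b1))
     = P ^ 4 * (x * (\<beta> + P * (w2 - w1)) / 3)"
      unfolding d(1) e(1) f(1) c_def w1(1) w2(1) by (simp add: field_simps eval_nat_numeral)
    show "x * (\<beta> + P * (w2 - w1)) / 3 \<in> Zp"
      by (intro Zp_intros x ab w1(2) w2(2)) simp
  qed
  finally show ?thesis
    unfolding x_def b1_def b2_def .
qed

end

theorem theorem1p3:
  fixes p :: nat
  assumes "prime p" and "p \<ge> 7"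
  shows "let P = (of_nat p :: rat); B = Bbar p; B2 = Bbar2 p;
             R = - 4 * B 1 + 6 * B 2 - 4 * B 3 + B 4
                 + P * (- 3 * B 1 ^ 2 + 4 * B 1 * B 2 - B 1 * B 3 - 1 / 2 * B 2 ^ 2)
                 + P ^ 2 * (- (2 / 3) * B 1 ^ 3 + 1 / 2 * B 1 ^ 2 * B 2
                            - 2 / 3 * B2 1 + 1 / 3 * B2 2)
                 - P ^ 3 * (1 / 24 * B 1 ^ 4 + 1 / 3 * B 1 * B2 1)
         in padic_cong p 4 (wilson_quotient p) R \<and>
            padic_cong p 5 (fact (p - 1)) (- 1 + P * R)"
proof -
  interpret prime_ge7 p
    using assms by unfold_locales
  have "padic_cong p 4 (wilson_quotient p) R \<and> padic_cong p 5 (fact (p - 1)) (- 1 + P * R)"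
    if "pcong 4 (wilson_quotient p) R" for R
  proof
    have W: "wilson_quotient p \<in> Zp" and R: "R \<in> Zp"
      using wilson_quotient_Zp pcong_Zp[OF pcong_sym[OF that]] by auto
    show "padic_cong p 4 (wilson_quotient p) R"
      using that W R unfolding padic_cong_def pcong_def by simp
    have "pcong (4 + 1) (P ^ 1 * wilson_quotient p) (P ^ 1 * R)"
      using that by (simp only: pcong_P_mult)
    then have "pcong 5 (- 1 + P * wilson_quotient p) (- 1 + P * R)"
      by (intro pcong_add) auto
    then show "padic_cong p 5 (fact (p - 1)) (- 1 + P * R)"
      using W R unfolding padic_cong_def pcong_def wilson_quotient_eq by simp
  qed
  from this[OF wilson_quotient_cong] show ?thesis
    by (simp only: Let_def)
qed

end
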